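(* Let $d\ge2$, $\mu>-\frac12$ and $\lambda=\mu+\frac{d-1}2$. For $\mathbf k\in\mathbb{N}_0^d$ with $|\mathbf k|\le n$ define $$\mathsf{V}_{\mathbf k,n}(x,t)=\sum_{2\mathbf j\le\mathbf k}c^\mu_{\mathbf k,\mathbf j}\,\mathsf{S}_{\mathbf k-2\mathbf j,n}(x,t).$$ Then $\mathsf{V}_{\mathbf k,n}(x,t)=t^{n-|\mathbf k|}x^{\mathbf k}+\cdots$ is a monomial polynomial of degree $n$ (that is, $\mathsf{V}_{\mathbf k,n}-t^{n-|\mathbf k|}x^{\mathbf k}$ is a polynomial of total degree at most $n-1$ in $(x,t)$), and the set $\{\mathsf{V}_{\mathbf k,n}:0\le|\mathbf k|\le n,\ \mathbf k\in\mathbb{N}_0^d\}$ is the monomial basis of $\mathcal{V}_n(\mathbb{V}^{d+1},W_\mu)$. Furthermore, $\mathsf{V}_{\mathbf k,n}$ satisfies $$\mathsf{V}_{\mathbf k,n}(x,t)=\sum_{2\mathbf i\le\mathbf k}x^{\mathbf k-2\mathbf i}\sum_{m=0}^{|\mathbf i|}q_{n-|\mathbf k|+2m}^{2(|\mathbf k|-2m)+2\mu+d-1}(t)\,t^{2|\mathbf i|-2m}B_{\mathbf i,m},$$ where $B_{\mathbf i,m}$ depends only on $|\mathbf i|$ and is defined by $$B_{\mathbf i,m}=\frac{(-1)^m\left(\frac{-\mathbf k}2\right)_{\mathbf i}\left(\frac{-\mathbf k+\mathbf 1}2\right)_{\mathbf i}}{(-|\mathbf k|-\lambda+1)_{|\mathbf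 i|+m}\,\mathbf i!}\binom{|\mathbf i|}{m}\bigl(2(-|\mathbf k|-\lambda+1)_m-(-|\mathbf k|-\lambda)_m\bigr).$$
   Context: Multi-index notation: for $\mathbf k,\mathbf j\in\mathbb{N}_0^d$, $\mathbf a\in\mathbb{R}^d$: $|\mathbf k|=k_1+\cdots+k_d$, $\mathbf k!=k_1!\cdots k_d!$, $x^{\mathbf k}=x_1^{k_1}\cdots x_d^{k_d}$, $(\mathbf a)_{\mathbf k}=(a_1)_{k_1}\cdots(a_d)_{k_d}$ with $(a)_k=a(a+1)\cdots(a+k-1)$, $\mathbf 1=(1,\dots,1)$; $2\mathbf j\le\mathbf k$ means $2j_i\le k_i$ for all $i$ and sums over such conditions run over $\mathbf j\in\mathbb{N}_0^d$. $\mathbb{V}^{d+1}=\{(x,t)\in\mathbb{R}^{d+1}:\|x\|\le t,\ t\ge0\}$, $W_\mu(x,t)=w(t)(t^2-\|x\|^2)^{\mu-\frac12}$, where $w$ is a weight function on $\mathbb{R}_+=[0,\infty)$ (possibly supported on $[0,1]$): $w\ge0$ and $\int_0^\infty t^{d+2\mu-1+j}w(t)\,dt$ is finite and positive for all integers $j\ge0$. $\mathcal{V}_n(\mathbb{V}^{d+1},W_\mu)$ is the space of polynomials of degree at most $n$ in $(x,t)$ orthogonal to all polynomials of degree at most $n-1$ with respect to $\langle f,g\rangle=\int_{\mathbb{V}^{d+1}}fg\,W_\mu\,dx\,dt$. The monomial basis of this space is its basis whose elements have the form $t^{n-|\mathbf k|}x^{\mathbf k}+(\text{degree}\le n-1)$,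 $|\mathbf k|\le n$. $q_j^\alpha$ is the monic orthogonal polynomial of degree $j$ with respect to $t^\alpha w(t)$ on $\mathbb{R}_+$. For $\mathbf k\in\mathbb{N}_0^d$, the monomial orthogonal polynomial on the unit ball (for the weight $(1-\|x\|^2)^{\mu-\frac12}$) is $$V_{\mathbf k}(x)=\sum_{2\mathbf j\le\mathbf k}b^\mu_{\mathbf k,\mathbf j}x^{\mathbf k-2\mathbf j},\qquad b^\mu_{\mathbf k,\mathbf j}=\frac{(-\frac{\mathbf k}2)_{\mathbf j}(\frac{-\mathbf k+\mathbf 1}2)_{\mathbf j}}{(-|\mathbf k|-\lambda+1)_{|\mathbf j|}\,\mathbf j!},$$ and, for $|\mathbf k|=m\le n$, $\mathsf{S}_{\mathbf k,n}(x,t)=q_{n-m}^{\alpha_m}(t)\,t^mV_{\mathbf k}(x/t)$ with $\alpha_m=2m+2\mu+d-1$. The coefficients $c^\mu_{\mathbf k,\mathbf j}$ are $$c^\mu_{\mathbf k,\mathbf j}=\frac{(-1)^{|\mathbf j|}(-\frac{\mathbf k}2)_{\mathbf j}(\frac{-\mathbf k+\mathbf 1}2)_{\mathbf j}}{(-|\mathbf k|-\lambda+1)_{2|\mathbf j|}\,\mathbf j!}\bigl(2(-|\mathbf k|-\lambda+1)_{|\mathbf j|}-(-|\mathbf k|-\lambda)_{|\mathbf j|}\bigr).$$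
   Formalization: The remark that B_{i,m} depends only on |i| is false (k=(2,4), i=(1,0) versus (0,1)); proved instead is that, for fixed k, B_{i,m} is (-k/2)_i((-k+1)/2)_i/i! times a quantity depending on i only through |i| (and on m). *)

theory Defs
  imports
    "HOL-Analysis.Analysis"
    "HOL-Library.Function_Algebras"
    "HOL-Computational_Algebra.Polynomial"
begin

section \<open>Multi-indices\<close>

text \<open>The dimension d is \<open>CARD('d)\<close>; multi-indices are functions \<open>'d \<Rightarrow> nat\<close>.\<close>

definition mdeg :: "('d::finite \<Rightarrow> nat) \<Rightarrow> nat"
  where "mdeg k = (\<Sum>i\<in>UNIV. k i)"

definition mfact :: "('d::finite \<Rightarrow> nat) \<Rightarrow> real"
  where "mfact k = (\<Prod>i\<in>UNIV. fact (k i))"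

definition mpow :: "real ^ 'd \<Rightarrow> ('d::finite \<Rightarrow> nat) \<Rightarrow> real"
  where "mpow x k = (\<Prod>i\<in>UNIV. (x $ i) ^ k i)"

definition mpoch :: "('d::finite \<Rightarrow> real) \<Rightarrow> ('d \<Rightarrow> nat) \<Rightarrow> real"
  where "mpoch a k = (\<Prod>i\<in>UNIV. pochhammer (a i) (k i))"

definition halves :: "('d::finite \<Rightarrow> nat) \<Rightarrow> ('d \<Rightarrow> nat) set"
  where "halves k = {j. \<forall>i. 2 * j i \<le> k i}"

definition minus2 :: "('d::finite \<Rightarrow> nat) \<Rightarrow> ('d \<Rightarrow> nat) \<Rightarrow> ('d \<Rightarrow> nat)"
  where "minus2 k j = (\<lambda>i. k i - 2 * j i)"

lemma finite_halves: "finite (halves k)"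
proof (rule finite_subset)
  show "halves k \<subseteq> PiE UNIV (\<lambda>i. {..k i})"
  proof
    fix j assume "j \<in> halves k"
    then have "2 * j i \<le> k i" for i by (simp add: halves_def)
    then have "j i \<le> k i" for i by (metis le_add2 mult_2 order_trans)
    then show "j \<in> PiE UNIV (\<lambda>i. {..k i})" by auto
  qed
qed (simp add: finite_PiE)

lemma mdeg_minus2:
  assumes "j \<in> halves k"
  shows "mdeg (minus2 k j) + 2 * mdeg j = mdeg k"
proof -
  have "mdeg (minus2 k j) + 2 * mdeg j = (\<Sum>i\<in>UNIV. (k i - 2 * j i) + 2 * j i)"
    by (simp add: mdeg_def minus2_def sum.distrib sum_distrib_left)
  also have "\<dots> = mdeg k"
    using assms by (simp add: mdeg_def halves_def)
  finally show ?thesis .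
qed

section \<open>Polynomials on the cone\<close>

text \<open>
  Polynomials in \<open>(x,t)\<close> are polynomial functions on the whole of \<open>\<real>\<^sup>d \<times> \<real>\<close>,
  inside the real vector space of all real-valued functions.
\<close>

interpretation fn: vector_space "\<lambda>(c::real) (f::'a \<Rightarrow> real). (\<lambda>z. c * f z)"
  by unfold_locales (auto simp: fun_eq_iff algebra_simps)

definition cone_mono :: "('d::finite \<Rightarrow> nat) \<Rightarrow> nat \<Rightarrow> (real ^ 'd) \<times> real \<Rightarrow> real"
  where "cone_mono k j = (\<lambda>(x, t). t ^ j * mpow x k)"

text \<open>Total degree at most \<open>N\<close>; the bound is an integer so that \<open>N = - 1\<close> gives only 0.\<close>

definition polys_le :: "int \<Rightarrow> ((real ^ 'd::finite) \<times> real \<Rightarrow> real) set"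
  where "polys_le N = fn.span {cone_mono k j |k j. int (mdeg k + j) \<le> N}"

definition cone :: "((real ^ 'd::finite) \<times> real) set"
  where "cone = {(x, t). norm x \<le> t \<and> 0 \<le> t}"

definition cone_weight_fun :: "(real \<Rightarrow> real) \<Rightarrow> real \<Rightarrow> (real ^ 'd::finite) \<times> real \<Rightarrow> real"
  where "cone_weight_fun w \<mu> = (\<lambda>(x, t). w t * (t\<^sup>2 - (norm x)\<^sup>2) powr (\<mu> - 1 / 2))"

definition cone_inner :: "(real \<Rightarrow> real) \<Rightarrow> real \<Rightarrow>
    ((real ^ 'd::finite) \<times> real \<Rightarrow> real) \<Rightarrow> ((real ^ 'd) \<times> real \<Rightarrow> real) \<Rightarrow> real"
  where "cone_inner w \<mu> f g =
    (LINT z:cone|lebesgue. f z * g z * cone_weight_fun w \<mu> z)"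

definition orth_space :: "(real \<Rightarrow> real) \<Rightarrow> real \<Rightarrow> nat \<Rightarrow> ((real ^ 'd::finite) \<times> real \<Rightarrow> real) set"
  where "orth_space w \<mu> n =
    {f \<in> polys_le (int n). \<forall>g \<in> polys_le (int n - 1). cone_inner w \<mu> f g = 0}"

text \<open>The measurability of \<open>w\<close> on \<open>\<real>\<^sub>+\<close> is part of the integrability of the moments.\<close>

definition admissible_weight :: "nat \<Rightarrow> real \<Rightarrow> (real \<Rightarrow> real) \<Rightarrow> bool"
  where "admissible_weight d \<mu> w \<longleftrightarrow>
    (\<forall>t\<ge>0. 0 \<le> w t) \<and>
    (\<forall>j::nat. let m = (\<lambda>t. t powr (real d + 2 * \<mu> - 1 + real j) * w t) in
       set_integrable lebesgue {0..} m \<and> 0 < (LINT t:{0..}|lebesgue. m t))"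

definition is_monomial_basis :: "(real \<Rightarrow> real) \<Rightarrow> real \<Rightarrow> nat \<Rightarrow>
    ((real ^ 'd::finite) \<times> real \<Rightarrow> real) set \<Rightarrow> bool"
  where "is_monomial_basis w \<mu> n B \<longleftrightarrow>
    \<not> fn.dependent B \<and> fn.span B = orth_space w \<mu> n \<and>
    (\<forall>f\<in>B. \<exists>k. mdeg k \<le> n \<and> f - cone_mono k (n - mdeg k) \<in> polys_le (int n - 1))"

section \<open>The polynomials S and V\<close>

text \<open>The monic orthogonal polynomial of degree \<open>j\<close> for the weight \<open>t\<^sup>\<alpha> w(t)\<close> on \<open>\<real>\<^sub>+\<close>.\<close>

definition monic_op :: "(real \<Rightarrow> real) \<Rightarrow> real \<Rightarrow> nat \<Rightarrow> real poly"
  where "monic_op w \<alpha> j = (THE p. degree p = j \<and> lead_coeff p = 1 \<and>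
    (\<forall>r. degree r < j \<longrightarrow>
      (LINT t:{0..}|lebesgue. poly p t * poly r t * (t powr \<alpha> * w t)) = 0))"

definition lam :: "real \<Rightarrow> nat \<Rightarrow> real"
  where "lam \<mu> d = \<mu> + (real d - 1) / 2"

definition half_poch :: "('d::finite \<Rightarrow> nat) \<Rightarrow> ('d \<Rightarrow> nat) \<Rightarrow> real"
  where "half_poch k j =
    mpoch (\<lambda>i. - real (k i) / 2) j * mpoch (\<lambda>i. (- real (k i) + 1) / 2) j"

definition bcoef :: "real \<Rightarrow> ('d::finite \<Rightarrow> nat) \<Rightarrow> ('d \<Rightarrow> nat) \<Rightarrow> real"
  where "bcoef \<mu> k j = half_poch k j /
    (pochhammer (- real (mdeg k) - lam \<mu> CARD('d) + 1) (mdeg j) * mfact j)"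

definition ccoef :: "real \<Rightarrow> ('d::finite \<Rightarrow> nat) \<Rightarrow> ('d \<Rightarrow> nat) \<Rightarrow> real"
  where "ccoef \<mu> k j = (- 1) ^ mdeg j * half_poch k j /
    (pochhammer (- real (mdeg k) - lam \<mu> CARD('d) + 1) (2 * mdeg j) * mfact j) *
    (2 * pochhammer (- real (mdeg k) - lam \<mu> CARD('d) + 1) (mdeg j)
       - pochhammer (- real (mdeg k) - lam \<mu> CARD('d)) (mdeg j))"

definition Bcoef :: "real \<Rightarrow> ('d::finite \<Rightarrow> nat) \<Rightarrow> ('d \<Rightarrow> nat) \<Rightarrow> nat \<Rightarrow> real"
  where "Bcoef \<mu> k i m = (- 1) ^ m * half_poch k i /
    (pochhammer (- real (mdeg k) - lam \<mu> CARD('d) + 1) (mdeg i + m) * mfact i) *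
    real (mdeg i choose m) *
    (2 * pochhammer (- real (mdeg k) - lam \<mu> CARD('d) + 1) m
       - pochhammer (- real (mdeg k) - lam \<mu> CARD('d)) m)"

definition ball_V :: "real \<Rightarrow> ('d::finite \<Rightarrow> nat) \<Rightarrow> real ^ 'd \<Rightarrow> real"
  where "ball_V \<mu> k x = (\<Sum>j\<in>halves k. bcoef \<mu> k j * mpow x (minus2 k j))"

text \<open>
  The polynomial \<open>t\<^sup>m V\<^sub>k(x/t)\<close> with \<open>m = mdeg k\<close>. It is written in homogenized form because
  division by zero gives 0 in HOL, so that the quotient form would be wrong at \<open>t = 0\<close>;
  for \<open>t \<noteq> 0\<close> the two agree by \<open>ball_V_hom_eq\<close>.
\<close>

definition ball_V_hom :: "real \<Rightarrow> ('d::finite \<Rightarrow> nat) \<Rightarrow> real ^ 'd \<Rightarrow> real \<Rightarrow> real"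
  where "ball_V_hom \<mu> k x t =
    (\<Sum>j\<in>halves k. bcoef \<mu> k j * mpow x (minus2 k j) * t ^ (2 * mdeg j))"

lemma mpow_scaleR: "mpow (c *\<^sub>R x) k = c ^ mdeg k * mpow x k"
  by (simp add: mpow_def mdeg_def power_mult_distrib prod.distrib power_sum)

lemma ball_V_hom_eq:
  assumes "t \<noteq> 0"
  shows "ball_V_hom \<mu> k x t = t ^ mdeg k * ball_V \<mu> k (x /\<^sub>R t)"
  unfolding ball_V_hom_def ball_V_def sum_distrib_left
proof (rule sum.cong[OF refl])
  fix j assume "j \<in> halves k"
  then have k: "t ^ mdeg k = t ^ mdeg (minus2 k j) * t ^ (2 * mdeg j)"
    by (metis mdeg_minus2 power_add)
  show "bcoef \<mu> k j * mpow x (minus2 k j) * t ^ (2 * mdeg j) =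
    t ^ mdeg k * (bcoef \<mu> k j * mpow (x /\<^sub>R t) (minus2 k j))"
    using assms by (simp add: k mpow_scaleR power_inverse field_simps)
qed

definition S_poly :: "(real \<Rightarrow> real) \<Rightarrow> real \<Rightarrow> ('d::finite \<Rightarrow> nat) \<Rightarrow> nat \<Rightarrow>
    (real ^ 'd) \<times> real \<Rightarrow> real"
  where "S_poly w \<mu> k n = (\<lambda>(x, t).
    poly (monic_op w (2 * real (mdeg k) + 2 * \<mu> + real CARD('d) - 1) (n - mdeg k)) t
      * ball_V_hom \<mu> k x t)"

definition V_poly :: "(real \<Rightarrow> real) \<Rightarrow> real \<Rightarrow> ('d::finite \<Rightarrow> nat) \<Rightarrow> nat \<Rightarrow>
    (real ^ 'd) \<times> real \<Rightarrow> real"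
  where "V_poly w \<mu> k n =
    (\<lambda>z. \<Sum>j\<in>halves k. ccoef \<mu> k j * S_poly w \<mu> (minus2 k j) n z)"

end

(* The homogeneous part of degree n of V_k is a sum of terms t^(n-|k|+2|l|) x^(k-2l). Splitting
   pochhammer symbols and a multi-index Vandermonde identity turn its coefficients into
   a terminating alternating sum of pochhammer quotients in |l|, which telescopes to 0 unless l = 0.

   For orthogonality, scaling x = t y separates the cone integrals into moments of the ball times
   moments of w. The moments M of the ball satisfy (|c| + 2 lambda) M(c) = (c_i - 1) M(c - 2 e_i),
   so the operator D = Laplacian - (x.grad)^2 - 2 lambda (x.grad) is symmetric with respect to M.
   The ball polynomial V_k is an eigenvector of D and x^a is one up to lower degree, with different
   eigenvalues if |a| < |k|; hence V_k is orthogonal to x^a. If |a| >= |k|, it is the radial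
   polynomial q that is orthogonal to the remaining power of t.

   Since the inner product is positive definite on polynomials, an orthogonal polynomial of degree n
   is determined by its leading form, which gives the spanning property and uniqueness. *)
theory Submission
  imports Defs
begin

section \<open>Coefficient identities\<close>

text \<open>The weight \<open>w\<close> is known only through Lebesgue integrability of its moments.
  It is replaced by a Borel function \<open>h\<close> that agrees almost everywhere with t^(d+2mu-1)
  w(t) for t > 0 and vanishes for t <= 0. With this power absorbed, the given moments become plain
  power moments of \<open>h\<close>, the weight t^alpha_m w becomes t^(2m) h, and the powers of t
  created by x = t y cancel. As \<open>h\<close> may live on any set of positive measure, positive
  definiteness cannot start from an open set where the weight is positive; it uses that a nonzero
  polynomial in t has finitely many roots. The degree and the weight of the radial factor of
  S_{k-2j,n} depend on j only through |j|. So the regrouping by x^(k-2l) is done once, with an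
  arbitrary F(|j|) as radial factor; powers of t give the leading form, the radial polynomials give
  the explicit formula. The recurrence for M is read off Gamma quotients, which avoids
  differentiating a weight that is singular on the sphere for mu < 1/2. The bound lambda > 0 keeps
  pochhammer denominators nonzero and makes |a|(|a| + 2 lambda), the negated eigenvalue, strictly
  increasing in |a|.\<close>

lemma half_poch_add:
  assumes "j \<in> halves k"
  shows "half_poch k (\<lambda>i. j i + l i) = half_poch k j * half_poch (minus2 k j) l"
proof -
  have *: "real (k i - 2 * j i) = real (k i) - 2 * real (j i)" for i
    using assms by (simp add: halves_def of_nat_diff)
  \<comment> \<open>Passing from k to k - 2j shifts both pochhammer arguments by exactly j, so
    (a)_(j+l) = (a)_j (a+j)_l splits each factor.\<close>
  have 1: "- (real (k i) - 2 * real (j i)) / 2 = - real (k i) / 2 + real (j i)" for i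
    by (simp add: field_simps)
  have 2: "(- (real (k i) - 2 * real (j i)) + 1) / 2 = (- real (k i) + 1) / 2 + real (j i)" for i
    by (simp add: field_simps)
  show ?thesis
    unfolding half_poch_def mpoch_def minus2_def * 1 2
    by (simp add: pochhammer_product' prod.distrib)
qed

lemma mdeg_add: "mdeg (\<lambda>i. j i + l i) = mdeg j + mdeg l"
  by (simp add: mdeg_def sum.distrib)

lemma prod_monom:
  "finite I \<Longrightarrow> (\<Prod>i\<in>I. monom (a i :: 'a :: comm_semiring_1) (e i)) = monom (\<Prod>i\<in>I. a i) (\<Sum>i\<in>I. e i)"
  by (induction I rule: finite_induct) (simp_all add: mult_monom)

text \<open>Vandermonde in several variables: compare coefficients in (1+X)^|l| = prod_i
  (1+X)^(l_i). The weight g sees j only through |j|, so it can be attached to each coefficient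
  separately.\<close>

lemma sum_mdeg_binomial:
  fixes g :: "nat \<Rightarrow> real" and l :: "'d::finite \<Rightarrow> nat"
  shows "(\<Sum>j\<in>{j. j \<le> l}. g (mdeg j) * (\<Prod>i\<in>UNIV. real (l i choose j i)))
    = (\<Sum>m\<le>mdeg l. g m * real (mdeg l choose m))"
proof -
  define q :: "real poly" where "q = [:1, 1:]"
  have coeff_q: "coeff (q ^ n) m = real (n choose m)" for n m
  proof (cases "m \<le> n")
    case False
    moreover have "degree (q ^ n) = n" by (simp add: degree_power_eq q_def)
    ultimately show ?thesis by (simp add: coeff_eq_0)
  qed (simp add: q_def coeff_linear_poly_power)
  have binom: "q ^ n = (\<Sum>j\<le>n. monom (real (n choose j)) j)" for n
    using poly_as_sum_of_monoms'[of "q ^ n" n] by (simp add: degree_power_eq q_def flip: coeff_q)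
  have set: "PiE UNIV (\<lambda>i. {..l i}) = {j. j \<le> l}"
    by (auto simp: PiE_def Pi_def le_fun_def)
  define P where "P j = (\<Prod>i\<in>UNIV. real (l i choose j i))" for j
  have "q ^ mdeg l = (\<Prod>i\<in>UNIV. q ^ l i)"
    by (simp add: mdeg_def power_sum)
  also have "\<dots> = (\<Sum>j\<in>{j. j \<le> l}. \<Prod>i\<in>UNIV. monom (real (l i choose j i)) (j i))"
    unfolding binom by (subst prod_sum_PiE) (simp_all add: set)
  also have "\<dots> = (\<Sum>j\<in>{j. j \<le> l}. monom (P j) (mdeg j))"
    by (simp add: prod_monom mdeg_def P_def)
  finally have eq: "q ^ mdeg l = (\<Sum>j\<in>{j. j \<le> l}. monom (P j) (mdeg j))" .
  have le: "mdeg j \<le> mdeg l" if "j \<le> l" for j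
    using that by (auto simp: mdeg_def le_fun_def intro: sum_mono)
  have coeff: "real (mdeg l choose m) = (\<Sum>j\<in>{j. j \<le> l}. if mdeg j = m then P j else 0)" for m
    using arg_cong[OF eq, of "\<lambda>p. coeff p m"] by (simp add: coeff_sum coeff_q)
  have "(\<Sum>m\<le>mdeg l. g m * real (mdeg l choose m))
      = (\<Sum>j\<in>{j. j \<le> l}. \<Sum>m\<le>mdeg l. if mdeg j = m then g m * P j else 0)"
    unfolding coeff sum_distrib_left by (subst sum.swap) (auto intro!: sum.cong)
  also have "\<dots> = (\<Sum>j\<in>{j. j \<le> l}. g (mdeg j) * P j)"
    by (intro sum.cong refl) (auto simp: le)
  finally show ?thesis by (simp add: P_def)
qed

lemma sum_mdeg_mfact:
  fixes g :: "nat \<Rightarrow> real" and l :: "'d::finite \<Rightarrow> nat"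
  shows "(\<Sum>j\<in>{j. j \<le> l}. g (mdeg j) / (mfact j * mfact (\<lambda>i. l i - j i)))
    = (\<Sum>m\<le>mdeg l. g m * real (mdeg l choose m)) / mfact l"
proof -
  have nz: "mfact l \<noteq> 0" by (simp add: mfact_def)
  have choose: "g (mdeg j) * (\<Prod>i\<in>UNIV. real (l i choose j i)) / mfact l
      = g (mdeg j) / (mfact j * mfact (\<lambda>i. l i - j i))" if "j \<le> l" for j
  proof -
    have "(\<Prod>i\<in>UNIV. real (l i choose j i)) = mfact l / (mfact j * mfact (\<lambda>i. l i - j i))"
      using that by (simp add: mfact_def binomial_fact le_fun_def prod_dividef prod.distrib)
    then show ?thesis using nz by simp
  qed
  have "(\<Sum>j\<in>{j. j \<le> l}. g (mdeg j) / (mfact j * mfact (\<lambda>i. l i - j i)))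
      = (\<Sum>j\<in>{j. j \<le> l}. g (mdeg j) * (\<Prod>i\<in>UNIV. real (l i choose j i)) / mfact l)"
    by (intro sum.cong refl choose[symmetric]) blast
  also have "\<dots> = (\<Sum>m\<le>mdeg l. g m * real (mdeg l choose m)) / mfact l"
    by (simp only: sum_divide_distrib[symmetric] sum_mdeg_binomial)
  finally show ?thesis .
qed

text \<open>The pairs (j, i) correspond to the pairs (l, j) with l = j + i. Here l is the index of
  the resulting monomial x^(k-2l), so the double sum becomes ordered by monomials.\<close>

lemma sum_halves_regroup:
  fixes f :: "('d::finite \<Rightarrow> nat) \<Rightarrow> ('d \<Rightarrow> nat) \<Rightarrow> real"
  shows "(\<Sum>j\<in>halves k. \<Sum>i\<in>halves (minus2 k j). f j i)
    = (\<Sum>l\<in>halves k. \<Sum>j\<in>{j. j \<le> l}. f j (\<lambda>i. l i - j i))"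
proof -
  have fin: "finite {j. j \<le> (l :: 'd \<Rightarrow> nat)}" for l
  proof (rule finite_subset)
    show "{j. j \<le> l} \<subseteq> PiE UNIV (\<lambda>i. {..l i})" by (auto simp: le_fun_def)
  qed (simp add: finite_PiE)
  have 1: "j \<in> halves k" "(\<lambda>i. l i - j i) \<in> halves (minus2 k j)" "(\<lambda>i. j i + (l i - j i)) = l"
    if "l \<in> halves k" "j \<le> l" for l j
  proof -
    have le: "j i \<le> l i" "2 * l i \<le> k i" for i using that by (auto simp: halves_def le_fun_def)
    have "2 * j i \<le> k i" "2 * (l i - j i) \<le> k i - 2 * j i" for i using le[of i] by linarith+
    then show "j \<in> halves k" "(\<lambda>i. l i - j i) \<in> halves (minus2 k j)" "(\<lambda>i. j i + (l i - j i)) = l"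
      using le by (auto simp: halves_def minus2_def)
  qed
  have 2: "(\<lambda>a. j a + i a) \<in> halves k" "j \<le> (\<lambda>a. j a + i a)" if "j \<in> halves k" "i \<in> halves (minus2 k j)" for j i
  proof -
    have "2 * j a \<le> k a" "2 * i a \<le> k a - 2 * j a" for a
      using that by (auto simp: halves_def minus2_def)
    then have "2 * (j a + i a) \<le> k a" for a
      by (metis add.commute distrib_left le_diff_conv2)
    then show "(\<lambda>a. j a + i a) \<in> halves k" "j \<le> (\<lambda>a. j a + i a)"
      by (auto simp: halves_def le_fun_def)
  qed
  have "(\<Sum>j\<in>halves k. \<Sum>i\<in>halves (minus2 k j). f j i)
      = (\<Sum>(j, i)\<in>Sigma (halves k) (\<lambda>j. halves (minus2 k j)). f j i)"
    by (simp add: sum.Sigma finite_halves)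
  also have "\<dots> = (\<Sum>(l, j)\<in>Sigma (halves k) (\<lambda>l. {j. j \<le> l}). f j (\<lambda>i. l i - j i))"
    by (rule sum.reindex_bij_witness[of _ "\<lambda>(l, j). (j, \<lambda>i. l i - j i)" "\<lambda>(j, i). (\<lambda>a. j a + i a, j)"])
       (use 1 2 in auto)
  also have "\<dots> = (\<Sum>l\<in>halves k. \<Sum>j\<in>{j. j \<le> l}. f j (\<lambda>i. l i - j i))"
    by (simp add: sum.Sigma finite_halves fin)
  finally show ?thesis .
qed

lemma minus2_minus2: "minus2 (minus2 k j) i = minus2 k (\<lambda>a. j a + i a)"
  by (simp add: minus2_def fun_eq_iff algebra_simps)

lemma lam_pos:
  assumes "\<mu> > - 1 / 2" "d \<ge> 2"
  shows "lam \<mu> d > 0"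
proof -
  have "real d \<ge> 2" using assms(2) by simp
  then have "(real d - 1) / 2 \<ge> 1 / 2" by simp
  moreover have "\<mu> > - (1 / 2)" using assms(1) by simp
  ultimately show ?thesis unfolding lam_def by linarith
qed

text \<open>Each factor is -K - x + 1 + i with i <= K - 1, hence at most -x < 0.\<close>

lemma pochhammer_minus_nz:
  fixes x :: real
  assumes "x > 0" "s \<le> K"
  shows "pochhammer (- real K - x + 1) s \<noteq> 0"
  unfolding pochhammer_eq_0_iff
proof
  assume "\<exists>i<s. - real K - x + 1 = - of_nat i"
  then obtain i where "i < s" "- real K - x + 1 = - real i" by auto
  moreover have "real i + 1 \<le> real K" using \<open>i < s\<close> assms(2) by linarith
  ultimately show False using assms(1) by linarith
qed

text \<open>F stands for any radial factor that depends on j only through |j|. The coefficient of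
  x^(k-2l) then collects all j <= l, and Vandermonde reduces these to one sum over m = |j|, which is
  where the binomial in \<open>Bcoef\<close> comes from.\<close>

lemma sum_V_coeffs:
  fixes k :: "'d::finite \<Rightarrow> nat" and F :: "nat \<Rightarrow> real"
  assumes lam: "lam \<mu> CARD('d) > 0"
  shows "(\<Sum>j\<in>halves k. ccoef \<mu> k j * (F (mdeg j) * ball_V_hom \<mu> (minus2 k j) x t))
    = (\<Sum>i\<in>halves k. mpow x (minus2 k i) *
        (\<Sum>m\<le>mdeg i. F m * t ^ (2 * mdeg i - 2 * m) * Bcoef \<mu> k i m))"
proof -
  define A where "A = - real (mdeg k) - lam \<mu> CARD('d) + 1"
  define Q where "Q m = 2 * pochhammer A m - pochhammer (A - 1) m" for m
  define h where "h l m = (- 1) ^ m * half_poch k l / pochhammer A (mdeg l + m) * Q m"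
    for l :: "'d \<Rightarrow> nat" and m
  have c: "ccoef \<mu> k j = (- 1) ^ mdeg j * half_poch k j / (pochhammer A (2 * mdeg j) * mfact j) * Q (mdeg j)"
    for j by (simp add: ccoef_def A_def Q_def)
  have summand: "ccoef \<mu> k j * bcoef \<mu> (minus2 k j) (\<lambda>a. l a - j a) =
      h l (mdeg j) / (mfact j * mfact (\<lambda>i. l i - j i))"
    if j: "j \<le> l" and l: "l \<in> halves k" for j l
  proof -
    have jk: "j \<in> halves k"
    proof -
      have "2 * j i \<le> k i" for i
        using j l unfolding halves_def le_fun_def by (auto intro: order_trans[of _ "2 * l i"])
      then show ?thesis by (simp add: halves_def)
    qed
    have lj: "(\<lambda>a. j a + (l a - j a)) = l" using j by (auto simp: le_fun_def)
    have hp: "half_poch k l = half_poch k j * half_poch (minus2 k j) (\<lambda>a. l a - j a)"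
      using half_poch_add[OF jk, of "\<lambda>a. l a - j a"] unfolding lj .
    have md: "mdeg l = mdeg j + mdeg (\<lambda>a. l a - j a)"
      using mdeg_add[of j "\<lambda>a. l a - j a"] unfolding lj .
    \<comment> \<open>As |k - 2j| = |k| - 2|j|, the pochhammer base of b_{k-2j} is A shifted by
      2|j|.\<close>
    have "- real (mdeg (minus2 k j)) - lam \<mu> CARD('d) + 1 = A + real (2 * mdeg j)"
      using mdeg_minus2[OF jk] by (simp add: A_def)
    then have b: "bcoef \<mu> (minus2 k j) (\<lambda>a. l a - j a) = half_poch (minus2 k j) (\<lambda>a. l a - j a) /
        (pochhammer (A + real (2 * mdeg j)) (mdeg (\<lambda>a. l a - j a)) * mfact (\<lambda>a. l a - j a))"
      by (simp add: bcoef_def)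
    \<comment> \<open>The denominator (A)_(2|j|) of c and the denominator (A + 2|j|)_|l-j| of b join
      to (A)_(|l|+|j|). Thus j remains only through |j| and the two factorials.\<close>
    have "mdeg l + mdeg j = 2 * mdeg j + mdeg (\<lambda>a. l a - j a)" using md by simp
    then have "pochhammer A (mdeg l + mdeg j) =
        pochhammer A (2 * mdeg j) * pochhammer (A + real (2 * mdeg j)) (mdeg (\<lambda>a. l a - j a))"
      by (simp only: pochhammer_product')
    then show ?thesis unfolding b c h_def hp by (simp only: times_divide_times_eq) (simp add: mult_ac)
  qed
  have "(\<Sum>j\<in>halves k. ccoef \<mu> k j * (F (mdeg j) * ball_V_hom \<mu> (minus2 k j) x t))
      = (\<Sum>j\<in>halves k. \<Sum>i\<in>halves (minus2 k j). F (mdeg j) * mpow x (minus2 k (\<lambda>a. j a + i a)) *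
          t ^ (2 * mdeg i) * (ccoef \<mu> k j * bcoef \<mu> (minus2 k j) i))"
    by (simp add: ball_V_hom_def sum_distrib_left minus2_minus2 mult_ac)
  also have "\<dots> = (\<Sum>l\<in>halves k. \<Sum>j\<in>{j. j \<le> l}. F (mdeg j) * mpow x (minus2 k (\<lambda>a. j a + (l a - j a))) *
          t ^ (2 * mdeg (\<lambda>a. l a - j a)) * (ccoef \<mu> k j * bcoef \<mu> (minus2 k j) (\<lambda>a. l a - j a)))"
    by (rule sum_halves_regroup)
  also have "\<dots> = (\<Sum>l\<in>halves k. mpow x (minus2 k l) * (\<Sum>j\<in>{j. j \<le> l}.
      (F (mdeg j) * t ^ (2 * mdeg l - 2 * mdeg j) * h l (mdeg j)) / (mfact j * mfact (\<lambda>i. l i - j i))))"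
    unfolding sum_distrib_left
  proof (intro sum.cong refl)
    fix l j assume l: "l \<in> halves k" and "j \<in> {j. j \<le> l}"
    then have j: "j \<le> l" by simp
    have lj: "(\<lambda>a. j a + (l a - j a)) = l" using j by (auto simp: le_fun_def)
    have md: "2 * mdeg (\<lambda>a. l a - j a) = 2 * mdeg l - 2 * mdeg j"
      using mdeg_add[of j "\<lambda>a. l a - j a"] unfolding lj by simp
    show "F (mdeg j) * mpow x (minus2 k (\<lambda>a. j a + (l a - j a))) *
          t ^ (2 * mdeg (\<lambda>a. l a - j a)) * (ccoef \<mu> k j * bcoef \<mu> (minus2 k j) (\<lambda>a. l a - j a))
      = mpow x (minus2 k l) * ((F (mdeg j) * t ^ (2 * mdeg l - 2 * mdeg j) * h l (mdeg j)) / (mfact j * mfact (\<lambda>i. l i - j i)))"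
      unfolding lj md summand[OF j l] by simp
  qed
  also have "\<dots> = (\<Sum>l\<in>halves k. mpow x (minus2 k l) *
      ((\<Sum>m\<le>mdeg l. (F m * t ^ (2 * mdeg l - 2 * m) * h l m) * real (mdeg l choose m)) / mfact l))"
    by (subst sum_mdeg_mfact) (rule refl)
  also have "\<dots> = (\<Sum>i\<in>halves k. mpow x (minus2 k i) *
        (\<Sum>m\<le>mdeg i. F m * t ^ (2 * mdeg i - 2 * m) * Bcoef \<mu> k i m))"
    by (simp add: sum_divide_distrib h_def Bcoef_def A_def Q_def mult_ac)
  finally show ?thesis .
qed

text \<open>The partial sums have a closed product form with the factor binomial(L-1, M), which is 0
  at M = L. Nonvanishing of (A)_(2L) covers all denominators (A)_(L+m) with m <= L.\<close>

lemma sum_alternating_pochhammer: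
  fixes A :: real
  assumes nz: "pochhammer A (2 * L) \<noteq> 0" and "L > 0"
  shows "(\<Sum>m\<le>L. (- 1) ^ m * real (L choose m) *
      (2 * pochhammer A m - pochhammer (A - 1) m) / pochhammer A (L + m)) = 0"
proof -
  have partial: "(\<Sum>m\<le>M. (- 1) ^ m * real (L choose m) *
      (2 * pochhammer A m - pochhammer (A - 1) m) / pochhammer A (L + m))
    = (- 1) ^ M * real (L - 1 choose M) * pochhammer A M / pochhammer A (L + M)" if "M \<le> L" for M
    using that
  proof (induction M)
    case (Suc M)
    have s: "pochhammer A (L + Suc M) \<noteq> 0"
      using pochhammer_neq_0_mono[OF nz, of "L + Suc M"] Suc.prems by simp
    define P where "P = pochhammer A (L + M)"
    define X where "X = pochhammer A M"
    have P: "pochhammer A (L + Suc M) = P * (A + L + M)"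
      by (simp add: P_def pochhammer_Suc add_ac)
    have nzP: "P \<noteq> 0" "A + L + M \<noteq> 0" using s unfolding P by auto
    have X1: "pochhammer A (Suc M) = X * (A + M)" by (simp add: X_def pochhammer_Suc)
    have X2: "pochhammer (A - 1) (Suc M) = (A - 1) * X"
      by (simp add: X_def pochhammer_rec)
    obtain N where N: "L = Suc N" using \<open>L > 0\<close> by (cases L) auto
    have b1: "real (L choose Suc M) = real (N choose M) + real (N choose Suc M)"
      by (simp add: N)
    have "Suc M * (Suc N choose Suc M) = Suc N * (N choose M)"
      by (rule Suc_times_binomial)
    from arg_cong[OF this, of real]
    have b2: "(real M + 1) * (real (N choose M) + real (N choose Suc M)) = (real N + 1) * real (N choose M)"
      by (simp only: of_nat_mult of_nat_Suc binomial_Suc_Suc of_nat_add) (simp add: add.commute)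
    \<comment> \<open>The induction step after division by the common pochhammer factors. The two
      sides differ by (M+1) binomial(L, M+1) - L binomial(L-1, M), which is 0 by absorption.\<close>
    have key: "real (L choose Suc M) * (2 * (A + M) - (A - 1)) - real (N choose M) * (A + L + M)
        = real (N choose Suc M) * (A + M)"
    proof -
      define p q where "p = real (N choose M)" and "q = real (N choose Suc M)"
      have b2': "(real M + 1) * (p + q) = (real N + 1) * p" using b2 by (simp only: p_def q_def)
      have "(p + q) * (2 * (A + M) - (A - 1)) - p * (A + (real N + 1) + M)
          - q * (A + M) = (real M + 1) * (p + q) - (real N + 1) * p" by algebra
      then have "(p + q) * (2 * (A + M) - (A - 1)) - p * (A + (real N + 1) + M) = q * (A + M)"
        unfolding b2' by simp
      moreover have "real L = real N + 1" by (simp add: N)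
      ultimately show ?thesis unfolding b1 p_def q_def by (simp only:)
    qed
    have "(\<Sum>m\<le>Suc M. (- 1) ^ m * real (L choose m) *
        (2 * pochhammer A m - pochhammer (A - 1) m) / pochhammer A (L + m))
      = (- 1) ^ M * real (N choose M) * X / P +
        (- 1) ^ Suc M * real (L choose Suc M) * (2 * (X * (A + M)) - (A - 1) * X) / (P * (A + L + M))"
      using Suc by (simp only: sum.atMost_Suc X1 X2 P) (simp add: N X_def P_def)
    also have "\<dots> = (- 1) ^ Suc M * X * (real (L choose Suc M) * (2 * (A + M) - (A - 1)) -
        real (N choose M) * (A + L + M)) / (P * (A + L + M))"
    proof -
      have "s * p * X / P + (- s) * c * (2 * (X * u) - v * X) / (P * D)
          = (- s) * X * (c * (2 * u - v) - p * D) / (P * D)" if "D \<noteq> 0" for s p c u v D :: real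
        using that nzP(1) by (simp add: divide_simps) algebra
      from this[OF nzP(2), of "(- 1) ^ M"] show ?thesis by simp
    qed
    also have "\<dots> = (- 1) ^ Suc M * real (N choose Suc M) * (X * (A + M)) / (P * (A + L + M))"
      unfolding key by simp
    finally show ?case unfolding X1 P by (simp add: N)
  qed simp
  show ?thesis using partial[of L] \<open>L > 0\<close> by (simp add: binomial_eq_0)
qed

text \<open>With F(m) = t^(r+2m) the power of t attached to x^(k-2i) is t^(r+2|i|), free of m. What
  remains is the plain sum of \<open>Bcoef\<close> over m, which is 1 at i = 0 and 0
  otherwise.\<close>

lemma sum_V_coeffs_leading:
  fixes k :: "'d::finite \<Rightarrow> nat"
  assumes lam: "lam \<mu> CARD('d) > 0"
  shows "(\<Sum>j\<in>halves k. ccoef \<mu> k j * (t ^ (r + 2 * mdeg j) * ball_V_hom \<mu> (minus2 k j) x t))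
    = t ^ r * mpow x k"
proof -
  let ?z = "\<lambda>_::'d. 0::nat"
  have B: "(\<Sum>m\<le>mdeg i. Bcoef \<mu> k i m) = (if i = ?z then 1 else 0)" if i: "i \<in> halves k" for i
  proof (cases "i = ?z")
    case True
    then show ?thesis by (simp add: Bcoef_def mdeg_def mfact_def half_poch_def mpoch_def)
  next
    case False
    then obtain a where "i a > 0" by (auto simp: fun_eq_iff)
    then have pos: "mdeg i > 0" using member_le_sum[of a UNIV i] by (simp add: mdeg_def)
    define A where "A = - real (mdeg k) - lam \<mu> CARD('d) + 1"
    have "2 * mdeg i \<le> mdeg k" using mdeg_minus2[OF i] by simp
    then have nz: "pochhammer A (2 * mdeg i) \<noteq> 0"
      unfolding A_def by (rule pochhammer_minus_nz[OF lam])
    have "(\<Sum>m\<le>mdeg i. Bcoef \<mu> k i m) = half_poch k i / mfact i *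
      (\<Sum>m\<le>mdeg i. (- 1) ^ m * real (mdeg i choose m) *
      (2 * pochhammer A m - pochhammer (A - 1) m) / pochhammer A (mdeg i + m))"
      by (simp add: Bcoef_def A_def sum_distrib_left mult_ac)
    then show ?thesis using sum_alternating_pochhammer[OF nz pos] False by simp
  qed
  have "(\<Sum>j\<in>halves k. ccoef \<mu> k j * (t ^ (r + 2 * mdeg j) * ball_V_hom \<mu> (minus2 k j) x t))
    = (\<Sum>i\<in>halves k. mpow x (minus2 k i) *
        (\<Sum>m\<le>mdeg i. t ^ (r + 2 * m) * t ^ (2 * mdeg i - 2 * m) * Bcoef \<mu> k i m))"
    by (rule sum_V_coeffs[OF lam])
  also have "\<dots> = (\<Sum>i\<in>halves k. mpow x (minus2 k i) * t ^ (r + 2 * mdeg i) * (\<Sum>m\<le>mdeg i. Bcoef \<mu> k i m))"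
    by (simp add: sum_distrib_left mult.assoc flip: power_add)
  also have "\<dots> = (\<Sum>i\<in>halves k. if i = ?z then t ^ r * mpow x k else 0)"
    by (intro sum.cong refl) (auto simp: B, simp add: minus2_def mdeg_def)
  also have "\<dots> = t ^ r * mpow x k"
    by (simp add: finite_halves) (simp add: halves_def)
  finally show ?thesis .
qed

section \<open>Orthogonality on the ball\<close>

lemma mdeg_fun_upd: "mdeg (f(i := x)) + f i = mdeg f + x"
  by (simp add: mdeg_def sum.remove[of UNIV i])

text \<open>Coefficient comparison in the eigenvalue equation: the second derivative in direction i
  sends the j' term of V_k to a multiple of x^(k-2j). In b_j / b_j' the numerator contributes the
  product of consecutive integers over 4, the pochhammer denominator -(|k| + lambda - |j|), and the
  factorial j_i.\<close>

lemma bcoef_step: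
  fixes k :: "'d::finite \<Rightarrow> nat"
  assumes lam: "lam \<mu> CARD('d) > 0" and j: "j \<in> halves k" and ji: "j i \<ge> 1"
  defines "j' \<equiv> j(i := j i - 1)"
  shows "bcoef \<mu> k j' * (real (k i - 2 * j' i) * (real (k i - 2 * j' i) - 1))
    = - 4 * real (j i) * (real (mdeg k) + lam \<mu> CARD('d) - real (mdeg j)) * bcoef \<mu> k j"
proof -
  define A where "A = - real (mdeg k) - lam \<mu> CARD('d) + 1"
  define e where "e a = (if a = i then 1 else 0 :: nat)" for a
  have j': "j' \<in> halves k"
  proof -
    have "2 * j a \<le> k a" for a using j by (auto simp: halves_def)
    then have "2 * j' a \<le> k a" for a
      by (metis diff_le_self fun_upd_apply j'_def mult_le_mono2 order_trans)
    then show ?thesis by (simp add: halves_def)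
  qed
  have je: "(\<lambda>a. j' a + e a) = j" using ji by (auto simp: j'_def e_def)
  have md: "mdeg j = Suc (mdeg j')" using mdeg_fun_upd[of j i "j i - 1"] ji by (simp add: j'_def)
  have "mpoch f e = f i" for f :: "'d \<Rightarrow> real"
  proof -
    have "mpoch f e = (\<Prod>a\<in>UNIV. if a = i then f a else 1)"
      unfolding mpoch_def by (intro prod.cong) (auto simp: e_def)
    then show ?thesis by simp
  qed
  then have "half_poch (minus2 k j') e =
      real (k i - 2 * j' i) * (real (k i - 2 * j' i) - 1) / 4"
    by (simp add: half_poch_def minus2_def field_simps)
  with half_poch_add[OF j', of e]
  have hp: "half_poch k j = half_poch k j' * (real (k i - 2 * j' i) * (real (k i - 2 * j' i) - 1) / 4)"
    unfolding je by simp
  have mf: "mfact j = real (j i) * mfact j'"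
    unfolding mfact_def by (subst (1 2) prod.remove[of _ i]) (use ji in \<open>auto simp: j'_def fact_reduce[of "j i"] intro!: prod.cong\<close>)
  have p: "pochhammer A (mdeg j) = pochhammer A (mdeg j') * (A + mdeg j')"
    unfolding md pochhammer_Suc by simp
  have "mdeg j \<le> mdeg k" using mdeg_minus2[OF j] by simp
  then have nz: "pochhammer A (mdeg j) \<noteq> 0"
    unfolding A_def by (rule pochhammer_minus_nz[OF lam])
  have nz2: "mfact j' \<noteq> 0" by (simp add: mfact_def)
  have X: "real (mdeg k) + lam \<mu> CARD('d) - real (mdeg j) = - (A + mdeg j')"
    by (simp add: A_def md)
  have b: "bcoef \<mu> k l = half_poch k l / (pochhammer A (mdeg l) * mfact l)" for l
    by (simp add: bcoef_def A_def)
  have "h / (P * f) * y = - 4 * r * (- u) * (h * (y / 4) / (P * u * (r * f)))"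
    if "P * u \<noteq> 0" "r \<noteq> 0" "f \<noteq> 0" for h P f y r u :: real
    using that by (simp add: field_simps)
  moreover have "real (j i) \<noteq> 0" using ji by simp
  ultimately show ?thesis
    using nz nz2 unfolding b X hp mf p by blast
qed

text \<open>M c is the value of a linear functional at x^c, \<open>U a\<close> its value at x^a V_k,
  \<open>R c s\<close> its value at x^(s-c) times the Laplacian of x^c, and -\<open>N c\<close> the
  eigenvalue of -(x.grad)^2 - 2 lambda (x.grad) at x^c. The recurrence is all that is required of
  M.\<close>

lemma ball_V_orthogonal:
  fixes k :: "'d::finite \<Rightarrow> nat" and M :: "('d \<Rightarrow> nat) \<Rightarrow> real"
  assumes lam: "lam \<mu> CARD('d) > 0"
    and M: "\<And>c i. c i \<ge> 1 \<Longrightarrow>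
      (real (mdeg c) + 2 * lam \<mu> CARD('d)) * M c = (real (c i) - 1) * M (c(i := c i - 2))"
    and a: "mdeg a < mdeg k"
  shows "(\<Sum>j\<in>halves k. bcoef \<mu> k j * M (\<lambda>i. minus2 k j i + a i)) = 0"
proof -
  define l where "l = lam \<mu> CARD('d)"
  define K where "K = real (mdeg k)"
  define U where "U a = (\<Sum>j\<in>halves k. bcoef \<mu> k j * M (\<lambda>i. minus2 k j i + a i))" for a
  define R where "R c s = (\<Sum>i\<in>UNIV. real (c i) * (real (c i) - 1) * M (s(i := s i - 2)))"
    for c s :: "'d \<Rightarrow> nat"
  define N where "N c = real (mdeg c) * (real (mdeg c) + 2 * l)" for c :: "'d \<Rightarrow> nat"
  \<comment> \<open>Symmetry of D, tested on x^c and x^a with s = c + a. Here c_i(c_i-1) -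
    a_i(a_i-1) = (c_i-a_i)(s_i-1), to which the recurrence applies; summing over i produces N c - N
    a.\<close>
  have sym: "R c s - N c * M s = R a s - N a * M s" if s: "s = (\<lambda>i. c i + a i)" for c a s
  proof -
    have "R c s - R a s = (\<Sum>i\<in>UNIV. (real (c i) - real (a i)) * ((real (s i) - 1) * M (s(i := s i - 2))))"
      unfolding R_def sum_subtractf[symmetric] s by (intro sum.cong refl) (simp add: algebra_simps)
    also have "\<dots> = (\<Sum>i\<in>UNIV. (real (c i) - real (a i)) * ((real (mdeg s) + 2 * l) * M s))"
    proof (intro sum.cong refl)
      fix i
      show "(real (c i) - real (a i)) * ((real (s i) - 1) * M (s(i := s i - 2))) =
          (real (c i) - real (a i)) * ((real (mdeg s) + 2 * l) * M s)"
        using M[of s i] s by (cases "s i \<ge> 1") (auto simp: l_def)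
    qed
    also have "\<dots> = (real (mdeg c) - real (mdeg a)) * ((real (mdeg s) + 2 * l) * M s)"
      by (simp add: mdeg_def sum_subtractf flip: sum_distrib_right)
    also have "real (mdeg s) = real (mdeg c) + real (mdeg a)"
      unfolding s mdeg_add by simp
    finally show ?thesis by (simp add: N_def algebra_simps)
  qed
  define s where "s a j = (\<lambda>i. minus2 k j i + a i)" for a j
  \<comment> \<open>The equation D V_k = -K(K+2l) V_k, multiplied by x^a and seen through M.\<close>
  have eigen: "(\<Sum>j\<in>halves k. bcoef \<mu> k j * (R (minus2 k j) (s a j) - N (minus2 k j) * M (s a j)))
      = - (K * (K + 2 * l)) * U a" for a
  proof -
    have "(\<Sum>j\<in>halves k. bcoef \<mu> k j * R (minus2 k j) (s a j)) =
      (\<Sum>i\<in>UNIV. \<Sum>j\<in>halves k. bcoef \<mu> k j * (real (minus2 k j i) * (real (minus2 k j i) - 1)) *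
          M ((s a j)(i := s a j i - 2)))"
      unfolding R_def sum_distrib_left by (subst sum.swap) (simp add: mult_ac)
    also have "\<dots> = (\<Sum>i\<in>UNIV. \<Sum>j\<in>halves k.
        - 4 * real (j i) * (K + l - real (mdeg j)) * bcoef \<mu> k j * M (s a j))"
    proof (rule sum.cong[OF refl])
      fix i
      have "(\<Sum>j\<in>halves k. bcoef \<mu> k j * (real (minus2 k j i) * (real (minus2 k j i) - 1)) *
          M ((s a j)(i := s a j i - 2)))
        = (\<Sum>j\<in>{j\<in>halves k. minus2 k j i \<ge> 2}. bcoef \<mu> k j * (real (minus2 k j i) * (real (minus2 k j i) - 1)) *
          M ((s a j)(i := s a j i - 2)))"
      proof (intro sum.mono_neutral_right ballI)
        fix j assume "j \<in> halves k - {j \<in> halves k. 2 \<le> minus2 k j i}"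
        then have "minus2 k j i = 0 \<or> minus2 k j i = 1" by auto
        then show "bcoef \<mu> k j * (real (minus2 k j i) * (real (minus2 k j i) - 1)) *
          M ((s a j)(i := s a j i - 2)) = 0" by auto
      qed (auto simp: finite_halves)
      also have "\<dots> = (\<Sum>j\<in>{j\<in>halves k. j i \<ge> 1}.
          - 4 * real (j i) * (K + l - real (mdeg j)) * bcoef \<mu> k j * M (s a j))"
      \<comment> \<open>Differentiating twice in direction i raises j_i by one. Terms with exponent
        0 or 1 have already been dropped, so the truncated subtraction of 2 is exact here.\<close>
      proof (rule sum.reindex_bij_witness[of _ "\<lambda>j. j(i := j i - 1)" "\<lambda>j. j(i := j i + 1)"])
        fix j assume j: "j \<in> {j \<in> halves k. 2 \<le> minus2 k j i}"
        then have ki: "2 * j i + 2 \<le> k i" by (auto simp: minus2_def)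
        show "(j(i := j i + 1))(i := (j(i := j i + 1)) i - 1) = j" by auto
        show j': "j(i := j i + 1) \<in> {j \<in> halves k. 1 \<le> j i}"
          using j ki by (auto simp: halves_def)
        have "s a (j(i := j i + 1)) = (s a j)(i := s a j i - 2)"
          using ki by (auto simp: s_def minus2_def)
        moreover have "bcoef \<mu> k j * (real (minus2 k j i) * (real (minus2 k j i) - 1)) =
            - 4 * real (j i + 1) * (K + l - real (mdeg (j(i := j i + 1)))) * bcoef \<mu> k (j(i := j i + 1))"
          using bcoef_step[OF lam, of "j(i := j i + 1)" k i] j' by (simp add: minus2_def K_def l_def)
        ultimately show "- 4 * real ((j(i := j i + 1)) i) * (K + l - real (mdeg (j(i := j i + 1)))) *
            bcoef \<mu> k (j(i := j i + 1)) * M (s a (j(i := j i + 1))) =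
          bcoef \<mu> k j * (real (minus2 k j i) * (real (minus2 k j i) - 1)) * M ((s a j)(i := s a j i - 2))"
          by simp
      next
        fix j assume j: "j \<in> {j \<in> halves k. 1 \<le> j i}"
        then have ji: "2 * j i \<le> k i" "j i \<ge> 1" by (auto simp: halves_def)
        show "(j(i := j i - 1))(i := (j(i := j i - 1)) i + 1) = j" using ji by auto
        have "2 * (j i - 1) \<le> k i" "2 \<le> k i - 2 * (j i - 1)" using ji by linarith+
        then show "j(i := j i - 1) \<in> {j \<in> halves k. 2 \<le> minus2 k j i}"
          using j by (auto simp: halves_def minus2_def)
      qed
      also have "\<dots> = (\<Sum>j\<in>halves k.
          - 4 * real (j i) * (K + l - real (mdeg j)) * bcoef \<mu> k j * M (s a j))"
        by (intro sum.mono_neutral_left) (auto simp: finite_halves)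
      finally show "(\<Sum>j\<in>halves k. bcoef \<mu> k j * (real (minus2 k j i) * (real (minus2 k j i) - 1)) *
          M ((s a j)(i := s a j i - 2))) = (\<Sum>j\<in>halves k.
          - 4 * real (j i) * (K + l - real (mdeg j)) * bcoef \<mu> k j * M (s a j))" .
    qed
    also have "\<dots> = (\<Sum>j\<in>halves k. \<Sum>i\<in>UNIV. real (j i) *
        (- 4 * (K + l - real (mdeg j)) * bcoef \<mu> k j * M (s a j)))"
      by (subst sum.swap) (intro sum.cong refl, simp add: algebra_simps)
    also have "\<dots> = (\<Sum>j\<in>halves k. - 4 * real (mdeg j) * (K + l - real (mdeg j)) * bcoef \<mu> k j * M (s a j))"
    proof (intro sum.cong refl)
      fix j
      show "(\<Sum>i\<in>UNIV. real (j i) * (- 4 * (K + l - real (mdeg j)) * bcoef \<mu> k j * M (s a j)))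
        = - 4 * real (mdeg j) * (K + l - real (mdeg j)) * bcoef \<mu> k j * M (s a j)"
        unfolding sum_distrib_right[symmetric] of_nat_sum[symmetric] mdeg_def[symmetric]
        by (simp add: algebra_simps)
    qed
    finally have "(\<Sum>j\<in>halves k. bcoef \<mu> k j * (R (minus2 k j) (s a j) - N (minus2 k j) * M (s a j)))
      = (\<Sum>j\<in>halves k. (- 4 * real (mdeg j) * (K + l - real (mdeg j)) - N (minus2 k j)) * (bcoef \<mu> k j * M (s a j)))"
      by (simp add: algebra_simps sum.distrib sum_subtractf)
    also have "\<dots> = (\<Sum>j\<in>halves k. (- (K * (K + 2 * l))) * (bcoef \<mu> k j * M (s a j)))"
    proof (intro sum.cong refl)
      fix j assume "j \<in> halves k"
      then have "K = real (mdeg (minus2 k j)) + 2 * real (mdeg j)"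
        using mdeg_minus2[of j k] by (simp add: K_def)
      then have "- 4 * real (mdeg j) * (K + l - real (mdeg j)) - N (minus2 k j) = - (K * (K + 2 * l))"
        unfolding N_def by (simp add: algebra_simps)
      then show "(- 4 * real (mdeg j) * (K + l - real (mdeg j)) - N (minus2 k j)) * (bcoef \<mu> k j * M (s a j))
        = (- (K * (K + 2 * l))) * (bcoef \<mu> k j * M (s a j))" by simp
    qed
    also have "\<dots> = - (K * (K + 2 * l)) * U a"
      by (simp only: U_def s_def sum_distrib_left)
    finally show ?thesis .
  qed
  have "U a = 0" if "mdeg a < mdeg k" for a
    using that
  proof (induction "mdeg a" arbitrary: a rule: less_induct)
    case less
    have "- (K * (K + 2 * l)) * U a = (\<Sum>j\<in>halves k. bcoef \<mu> k j * (R a (s a j) - N a * M (s a j)))"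
      unfolding eigen[symmetric] by (intro sum.cong refl arg_cong2[of _ _ _ _ times] sym) (simp add: s_def)
    also have "\<dots> = (\<Sum>j\<in>halves k. bcoef \<mu> k j * R a (s a j)) - N a * U a"
      by (simp add: U_def s_def algebra_simps sum_subtractf sum_distrib_left)
    also have "(\<Sum>j\<in>halves k. bcoef \<mu> k j * R a (s a j)) =
      (\<Sum>i\<in>UNIV. real (a i) * (real (a i) - 1) * (\<Sum>j\<in>halves k. bcoef \<mu> k j * M ((s a j)(i := s a j i - 2))))"
      unfolding R_def sum_distrib_left by (subst sum.swap) (simp add: mult_ac)
    also have "\<dots> = 0"
    proof (intro sum.neutral ballI)
      fix i
      show "real (a i) * (real (a i) - 1) * (\<Sum>j\<in>halves k. bcoef \<mu> k j * M ((s a j)(i := s a j i - 2))) = 0"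
      proof (cases "a i \<ge> 2")
        case True
        have "(s a j)(i := s a j i - 2) = (\<lambda>b. minus2 k j b + (a(i := a i - 2)) b)" for j
          using True by (auto simp: s_def)
        then have "(\<Sum>j\<in>halves k. bcoef \<mu> k j * M ((s a j)(i := s a j i - 2))) = U (a(i := a i - 2))"
          by (simp only: U_def)
        moreover have "mdeg (a(i := a i - 2)) < mdeg a"
          using mdeg_fun_upd[of a i "a i - 2"] True by linarith
        ultimately show ?thesis using less by simp
      next
        case False
        then have "a i = 0 \<or> a i = 1" by auto
        then show ?thesis by auto
      qed
    qed
    \<comment> \<open>The second-order part of D x^a involves only M(V_k x^(a-2e_i)), which vanishes
      by induction. The eigenvalue gap is then the only obstacle to \<open>U a\<close> being
      0.\<close>
    finally have eq: "(K * (K + 2 * l) - N a) * U a = 0" by (simp add: algebra_simps)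
    have "real (mdeg a) < K" "l > 0" using less.prems lam by (auto simp: K_def l_def)
    then have "N a < K * (K + 2 * l)" unfolding N_def by (intro mult_strict_mono) auto
    then show ?case using eq by simp
  qed
  from this[OF a] show ?thesis by (simp only: U_def)
qed

section \<open>Moments of the ball\<close>

text \<open>Substitute s = t^2 - r^2 on the compact intervals [r, r+n] and let n grow by monotone
  convergence. Negative values of f do no harm: \<open>ennreal\<close> sends both integrands to 0
  there because 2t >= 0.\<close>

lemma nn_integral_square_shift:
  fixes f :: "real \<Rightarrow> real"
  assumes [measurable]: "f \<in> borel_measurable borel" and r: "r \<ge> 0"
  shows "(\<integral>\<^sup>+s. ennreal (f s * indicator {0..} s) \<partial>lborel)
    = (\<integral>\<^sup>+t. ennreal (f (t\<^sup>2 - r\<^sup>2) * (2 * t) * indicator {r..} t) \<partial>lborel)"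
proof -
  define g where "g t = t\<^sup>2 - r\<^sup>2" for t
  have eq: "(\<integral>\<^sup>+s. ennreal (f s * indicator {g r..g (r + real n)} s) \<partial>lborel)
      = (\<integral>\<^sup>+t. ennreal (f (g t) * (2 * t) * indicator {r..r + real n} t) \<partial>lborel)" for n :: nat
    by (rule nn_integral_substitution)
      (use r in \<open>auto simp: g_def set_borel_measurable_def intro!: derivative_eq_intros continuous_intros\<close>)
  have mono: "g (r + real m) \<le> g (r + real n)" if "m \<le> n" for m n
    using that r unfolding g_def by (simp add: power_mono)
  \<comment> \<open>Growth of g makes the image intervals exhaust the half-line.\<close>
  have lin: "real n \<le> g (r + real n) \<or> n = 0" for n
  proof (cases n)
    case (Suc m)
    then have "real n * 1 \<le> real n * real n" by (intro mult_left_mono) auto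
    then have "real n \<le> (real n)\<^sup>2" by (simp add: power2_eq_square)
    moreover have "0 \<le> 2 * r * real n" using r by simp
    ultimately show ?thesis unfolding g_def power2_sum by linarith
  qed simp
  have A: "(\<lambda>n. \<integral>\<^sup>+s. ennreal (f s * indicator {g r..g (r + real n)} s) \<partial>lborel)
      \<longlonglongrightarrow> (\<integral>\<^sup>+s. ennreal (f s * indicator {0..} s) \<partial>lborel)"
  proof (rule nn_integral_LIMSEQ)
    show "incseq (\<lambda>n s. ennreal (f s * indicator {g r..g (r + real n)} s))"
      by (auto simp: incseq_def le_fun_def indicator_def dest: order_trans[OF _ mono])
    show "(\<lambda>n. ennreal (f s * indicator {g r..g (r + real n)} s)) \<longlonglongrightarrow> ennreal (f s * indicator {0..} s)" for s
    proof (rule tendsto_eventually, rule eventually_sequentiallyI)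
      fix n assume n: "Suc (nat \<lceil>\<bar>s\<bar>\<rceil>) \<le> n"
      then have "s \<le> real n" by linarith
      moreover have "real n \<le> g (r + real n)" using lin[of n] n by simp
      ultimately show "ennreal (f s * indicator {g r..g (r + real n)} s) = ennreal (f s * indicator {0..} s)"
        by (auto simp: indicator_def) (auto simp: g_def)
    qed
  qed simp
  have B: "(\<lambda>n. \<integral>\<^sup>+t. ennreal (f (g t) * (2 * t) * indicator {r..r + real n} t) \<partial>lborel)
      \<longlonglongrightarrow> (\<integral>\<^sup>+t. ennreal (f (g t) * (2 * t) * indicator {r..} t) \<partial>lborel)"
  proof (rule nn_integral_LIMSEQ)
    show "incseq (\<lambda>n t. ennreal (f (g t) * (2 * t) * indicator {r..r + real n} t))"
      by (auto simp: incseq_def le_fun_def indicator_def)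
    show "(\<lambda>n. ennreal (f (g t) * (2 * t) * indicator {r..r + real n} t)) \<longlonglongrightarrow>
        ennreal (f (g t) * (2 * t) * indicator {r..} t)" for t
    proof (rule tendsto_eventually, rule eventually_sequentiallyI)
      fix n assume n: "nat \<lceil>\<bar>t\<bar>\<rceil> \<le> n"
      then have "t \<le> real n" by linarith
      then show "ennreal (f (g t) * (2 * t) * indicator {r..r + real n} t) =
          ennreal (f (g t) * (2 * t) * indicator {r..} t)"
        using r by (auto simp: indicator_def)
    qed
  qed (simp add: g_def)
  show ?thesis
    using LIMSEQ_unique[OF A B[folded eq]] by (simp add: g_def)
qed

lemma nn_integral_gaussian_powr:
  assumes "p > - 2"
  shows "(\<integral>\<^sup>+t. ennreal (t powr p * exp (- t\<^sup>2) * (2 * t) * indicator {0..} t) \<partial>lborel)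
    = ennreal (Gamma (p / 2 + 1))"
proof -
  have "ennreal (Gamma (p / 2 + 1)) =
      (\<integral>\<^sup>+s. ennreal (s powr (p / 2) * exp (- s) * indicator {0..} s) \<partial>lborel)"
    using assms by (subst Gamma_conv_nn_integral_real)
      (auto intro!: nn_integral_cong simp: exp_minus field_simps indicator_def)
  also have "\<dots> = (\<integral>\<^sup>+t. ennreal ((t\<^sup>2 - 0\<^sup>2) powr (p / 2) * exp (- (t\<^sup>2 - 0\<^sup>2)) * (2 * t) * indicator {0..} t) \<partial>lborel)"
    by (rule nn_integral_square_shift) auto
  also have "\<dots> = (\<integral>\<^sup>+t. ennreal (t powr p * exp (- t\<^sup>2) * (2 * t) * indicator {0..} t) \<partial>lborel)"
  proof (intro nn_integral_cong)
    fix t :: real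
    show "ennreal ((t\<^sup>2 - 0\<^sup>2) powr (p / 2) * exp (- (t\<^sup>2 - 0\<^sup>2)) * (2 * t) * indicator {0..} t) =
        ennreal (t powr p * exp (- t\<^sup>2) * (2 * t) * indicator {0..} t)"
    proof (cases "t > 0")
      case True
      then have "(t\<^sup>2) powr (p / 2) = t powr p"
        by (simp add: powr_powr flip: powr_numeral)
      then show ?thesis by simp
    qed (auto simp: indicator_def)
  qed
  finally show ?thesis ..
qed

lemma nn_integral_abs_power_gaussian:
  "(\<integral>\<^sup>+s. ennreal (\<bar>s\<bar> ^ n * exp (- s\<^sup>2)) \<partial>lborel) = ennreal (Gamma ((real n + 1) / 2))"
proof -
  define f where "f s = \<bar>s\<bar> ^ n * exp (- s\<^sup>2)" for s :: real
  have [measurable]: "f \<in> borel_measurable borel" unfolding f_def by measurable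
  have half: "(\<integral>\<^sup>+s. ennreal (2 * f s * indicator {0..} s) \<partial>lborel) = ennreal (Gamma ((real n + 1) / 2))"
  proof -
    have "(\<integral>\<^sup>+s. ennreal (2 * f s * indicator {0..} s) \<partial>lborel)
      = (\<integral>\<^sup>+t. ennreal (t powr (real n - 1) * exp (- t\<^sup>2) * (2 * t) * indicator {0..} t) \<partial>lborel)"
    \<comment> \<open>The point t = 0 must be left out: for n = 0 the left integrand is 2 there, the
      right one 0.\<close>
    proof (intro nn_integral_cong_AE, rule AE_mp[OF AE_lborel_singleton[of 0]], intro AE_I2 impI)
      fix t :: real assume "t \<noteq> 0"
      show "ennreal (2 * f t * indicator {0..} t) =
          ennreal (t powr (real n - 1) * exp (- t\<^sup>2) * (2 * t) * indicator {0..} t)"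
      proof (cases "t > 0")
        case True
        then have "t ^ n = t powr (real n - 1) * t"
          by (simp add: powr_diff powr_realpow)
        then show ?thesis using True by (simp add: f_def mult_ac)
      qed (use \<open>t \<noteq> 0\<close> in auto)
    qed
    also have "\<dots> = ennreal (Gamma ((real n - 1) / 2 + 1))"
      by (rule nn_integral_gaussian_powr) simp
    also have "(real n - 1) / 2 + 1 = (real n + 1) / 2" by (simp add: field_simps)
    finally show ?thesis .
  qed
  have refl: "(\<integral>\<^sup>+s. ennreal (f s * indicator {..0} s) \<partial>lborel) = (\<integral>\<^sup>+s. ennreal (f s * indicator {0..} s) \<partial>lborel)"
    by (subst nn_integral_real_affine[where c="-1" and t=0])
       (auto simp: f_def indicator_def intro!: nn_integral_cong)
  have "(\<integral>\<^sup>+s. ennreal (f s) \<partial>lborel) =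
      (\<integral>\<^sup>+s. ennreal (f s * indicator {0..} s) + ennreal (f s * indicator {..0} s) \<partial>lborel)"
    by (intro nn_integral_cong_AE, rule AE_mp[OF AE_lborel_singleton[of 0]], intro AE_I2 impI)
       (auto simp: indicator_def)
  also have "\<dots> = (\<integral>\<^sup>+s. ennreal (f s * indicator {0..} s) \<partial>lborel) + (\<integral>\<^sup>+s. ennreal (f s * indicator {..0} s) \<partial>lborel)"
    by (rule nn_integral_add) auto
  also have "\<dots> = 2 * (\<integral>\<^sup>+s. ennreal (f s * indicator {0..} s) \<partial>lborel)"
    unfolding refl by (simp add: mult_2)
  also have "\<dots> = (\<integral>\<^sup>+s. ennreal (2 * f s * indicator {0..} s) \<partial>lborel)"
    by (subst nn_integral_cmult[symmetric])
       (auto simp: f_def ennreal_mult' mult.assoc intro!: nn_integral_cong)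
  finally show ?thesis unfolding half by (simp add: f_def)
qed

lemma nn_integral_mpow_gaussian:
  fixes a :: "'d::finite \<Rightarrow> nat"
  shows "(\<integral>\<^sup>+x. ennreal (\<bar>mpow x a\<bar> * exp (- (norm x)\<^sup>2)) \<partial>lborel)
    = ennreal (\<Prod>i\<in>UNIV. Gamma ((real (a i) + 1) / 2))"
proof -
  define f where "f b s = ennreal (\<bar>s\<bar> ^ a (axis_index b) * exp (- s\<^sup>2))" for b :: "real ^ 'd" and s :: real
  have Basis: "(\<Prod>b\<in>(Basis :: (real ^ 'd) set). F b) = (\<Prod>i\<in>UNIV. F (axis i 1))" for F :: "_ \<Rightarrow> ennreal"
  proof -
    have B: "(Basis :: (real ^ 'd) set) = range (\<lambda>i. axis i 1)" by (auto simp: Basis_vec_def)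
    have "inj (\<lambda>i::'d. axis i (1::real))" by (auto simp: inj_on_def axis_eq_axis)
    then show ?thesis unfolding B by (subst prod.reindex) auto
  qed
  have "(\<integral>\<^sup>+x. ennreal (\<bar>mpow x a\<bar> * exp (- (norm x)\<^sup>2)) \<partial>lborel) =
      (\<integral>\<^sup>+x. (\<Prod>b\<in>Basis. f b (x \<bullet> b)) \<partial>lborel)"
  proof (intro nn_integral_cong)
    fix x :: "real ^ 'd"
    have "(norm x)\<^sup>2 = (\<Sum>i\<in>UNIV. (x $ i)\<^sup>2)"
      by (simp add: norm_vec_def L2_set_def sum_nonneg)
    then show "ennreal (\<bar>mpow x a\<bar> * exp (- (norm x)\<^sup>2)) = (\<Prod>b\<in>Basis. f b (x \<bullet> b))"
      by (simp add: Basis f_def inner_axis prod_ennreal mpow_def prod.distrib abs_prod power_abs exp_sum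
          flip: sum_negf)
  qed
  also have "\<dots> = (\<Prod>b\<in>Basis. \<integral>\<^sup>+s. f b s \<partial>lborel)"
    by (rule nn_integral_lborel_prod) (auto simp: f_def)
  also have "\<dots> = ennreal (\<Prod>i\<in>UNIV. Gamma ((real (a i) + 1) / 2))"
    by (simp add: Basis f_def nn_integral_abs_power_gaussian prod_ennreal)
  finally show ?thesis .
qed

section \<open>Scaling, the weight of the ball and its moments\<close>

lemma nn_integral_scale:
  fixes f :: "'a::euclidean_space \<Rightarrow> ennreal"
  assumes [measurable]: "f \<in> borel_measurable borel" and t: "t > 0"
  shows "(\<integral>\<^sup>+x. f x \<partial>lborel) = ennreal (t ^ DIM('a)) * (\<integral>\<^sup>+x. f (t *\<^sub>R x) \<partial>lborel)"
  by (subst lborel_affine[of t 0]) (use t in \<open>simp_all add: nn_integral_density nn_integral_distr nn_integral_cmult\<close>)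

lemma integral_scale:
  fixes f :: "'a::euclidean_space \<Rightarrow> real"
  assumes [measurable]: "f \<in> borel_measurable borel" and t: "t > 0"
  shows "(LINT x|lborel. f x) = t ^ DIM('a) * (LINT x|lborel. f (t *\<^sub>R x))"
  by (subst lborel_affine[of t 0]) (use t in \<open>simp_all add: integral_density integral_distr\<close>)

text \<open>The slice of the cone weight at height t, extended by 0 so that all integrals run over
  the whole space.\<close>

definition ball_wt :: "real \<Rightarrow> real \<Rightarrow> real ^ 'd::finite \<Rightarrow> real"
  where "ball_wt \<mu> t x = (if norm x \<le> t then (t\<^sup>2 - (norm x)\<^sup>2) powr (\<mu> - 1 / 2) else 0)"

lemma ball_wt_nonneg: "ball_wt \<mu> t x \<ge> 0"
  by (simp add: ball_wt_def)

lemma ball_wt_measurable [measurable (raw)]: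
  assumes [measurable]: "f \<in> borel_measurable M" "g \<in> borel_measurable M"
  shows "(\<lambda>z. ball_wt \<mu> (f z) (g z)) \<in> borel_measurable M"
  unfolding ball_wt_def by measurable

lemma mpow_continuous: "continuous_on UNIV (\<lambda>x. mpow x a)"
  unfolding mpow_def by (intro continuous_intros)

lemma mpow_measurable [measurable (raw)]:
  assumes "g \<in> borel_measurable M"
  shows "(\<lambda>z. mpow (g z) a) \<in> borel_measurable M"
  using measurable_compose[OF assms borel_measurable_continuous_onI[OF mpow_continuous[of a]]] .

lemma ball_wt_scale:
  assumes "t > 0"
  shows "ball_wt \<mu> t (t *\<^sub>R y) = t powr (2 * \<mu> - 1) * ball_wt \<mu> 1 y"
proof (cases "norm y \<le> 1")
  case True
  have "t\<^sup>2 - (norm (t *\<^sub>R y))\<^sup>2 = t\<^sup>2 * (1 - (norm y)\<^sup>2)"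
    by (simp add: power_mult_distrib algebra_simps)
  moreover have "t\<^sup>2 = t powr 2" using assms by simp
  then have "(t\<^sup>2) powr (\<mu> - 1 / 2) = t powr (2 * \<mu> - 1)"
    by (simp only: powr_powr) (simp add: algebra_simps)
  moreover have "(norm y)\<^sup>2 \<le> 1" using True by (simp add: power_le_one)
  ultimately have "(t\<^sup>2 - (norm (t *\<^sub>R y))\<^sup>2) powr (\<mu> - 1 / 2) = t powr (2 * \<mu> - 1) * (1 - (norm y)\<^sup>2) powr (\<mu> - 1 / 2)"
    by (simp add: powr_mult)
  then show ?thesis using True assms by (simp add: ball_wt_def)
qed (use assms in \<open>simp add: ball_wt_def\<close>)

text \<open>Evaluating the integral of \<open>\<bar>x\<^sup>a\<bar> (t\<^sup>2 - \<parallel>x\<parallel>\<^sup>2)\<^sup>\<mu>\<^sup>-\<^sup>1\<^sup>/\<^sup>2 exp(-t\<^sup>2) 2t\<close>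
  over the cone in both orders reduces the moments of the ball to Gaussian moments.\<close>

lemma nn_integral_ball_abs_moment:
  fixes a :: "'d::finite \<Rightarrow> nat"
  assumes mu: "\<mu> > - 1 / 2"
  shows "(\<integral>\<^sup>+x. ennreal (\<bar>mpow x a\<bar> * ball_wt \<mu> 1 x) \<partial>lborel) = ennreal (Gamma (\<mu> + 1 / 2) *
    (\<Prod>i\<in>UNIV. Gamma ((real (a i) + 1) / 2)) / Gamma (real (mdeg a) / 2 + lam \<mu> CARD('d) + 1))"
proof -
  \<comment> \<open>Scaling x = t y yields t^|a| from the monomial, t^(2mu-1) from the weight and
    t^d from the volume element.\<close>
  define p where "p = real (mdeg a) + 2 * \<mu> - 1 + real CARD('d)"
  define C where "C = (\<integral>\<^sup>+x. ennreal (\<bar>mpow x a\<bar> * ball_wt \<mu> 1 x) \<partial>lborel)"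
  define G where "G = Gamma (p / 2 + 1)"
  define F where "F x t = ennreal (\<bar>mpow x a\<bar> * ball_wt \<mu> t x * (exp (- t\<^sup>2) * (2 * t)))" for x t
  have [measurable]: "(\<lambda>(x, t). F x t) \<in> borel_measurable (lborel \<Otimes>\<^sub>M lborel)"
    unfolding F_def by measurable
  have card: "real CARD('d) \<ge> 1" using zero_less_card_finite[where 'a='d] by linarith
  have "2 * \<mu> > - 1" "real (mdeg a) \<ge> 0" using mu by simp_all
  then have p: "p > - 1" using card unfolding p_def by linarith
  \<comment> \<open>For fixed x, the substitution s = t^2 - |x|^2 splits exp(-t^2) into exp(-|x|^2)
    exp(-s) and leaves an Euler integral in s.\<close>
  have inner_t: "(\<integral>\<^sup>+t. F x t \<partial>lborel) =
      ennreal (Gamma (\<mu> + 1 / 2)) * ennreal (\<bar>mpow x a\<bar> * exp (- (norm x)\<^sup>2))" for x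
  proof -
    define D where "D = \<bar>mpow x a\<bar> * exp (- (norm x)\<^sup>2)"
    define f where "f s = s powr (\<mu> - 1 / 2) * exp (- s)" for s :: real
    have [measurable]: "f \<in> borel_measurable borel" unfolding f_def by measurable
    have D: "D \<ge> 0" by (simp add: D_def)
    have "F x t = ennreal D * ennreal (f (t\<^sup>2 - (norm x)\<^sup>2) * (2 * t) * indicator {norm x..} t)" for t
    proof (cases "norm x \<le> t")
      case True
      have "exp (- t\<^sup>2) = exp (- (norm x)\<^sup>2) * exp (- (t\<^sup>2 - (norm x)\<^sup>2))"
        by (simp flip: exp_add)
      then show ?thesis using True D
        by (simp add: F_def D_def f_def ball_wt_def ennreal_mult'[symmetric] mult_ac)
    qed (simp add: F_def ball_wt_def)
    then have "(\<integral>\<^sup>+t. F x t \<partial>lborel) =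
        ennreal D * (\<integral>\<^sup>+t. ennreal (f (t\<^sup>2 - (norm x)\<^sup>2) * (2 * t) * indicator {norm x..} t) \<partial>lborel)"
      by (simp add: nn_integral_cmult)
    also have "\<dots> = ennreal D * (\<integral>\<^sup>+s. ennreal (f s * indicator {0..} s) \<partial>lborel)"
      by (subst nn_integral_square_shift) auto
    also have "(\<integral>\<^sup>+s. ennreal (f s * indicator {0..} s) \<partial>lborel) = ennreal (Gamma (\<mu> + 1 / 2))"
      using mu by (subst Gamma_conv_nn_integral_real)
        (auto intro!: nn_integral_cong simp: f_def exp_minus field_simps indicator_def)
    finally show ?thesis by (simp add: D_def mult.commute)
  qed
  have inner_x: "(\<integral>\<^sup>+x. F x t \<partial>lborel) = C * ennreal (t powr p * exp (- t\<^sup>2) * (2 * t) * indicator {0..} t)" for t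
  proof (cases "t > 0")
    case True
    have "(\<integral>\<^sup>+x. F x t \<partial>lborel) = ennreal (t ^ CARD('d)) * (\<integral>\<^sup>+x. F (t *\<^sub>R x) t \<partial>lborel)"
      using nn_integral_scale[of "\<lambda>x. F x t" t] True by (simp add: F_def)
    also have "(\<lambda>x. F (t *\<^sub>R x) t) = (\<lambda>x. ennreal (t ^ mdeg a * t powr (2 * \<mu> - 1) * exp (- t\<^sup>2) * (2 * t)) *
        ennreal (\<bar>mpow x a\<bar> * ball_wt \<mu> 1 x))"
    proof (rule ext)
      fix x
      have "F (t *\<^sub>R x) t = ennreal ((t ^ mdeg a * t powr (2 * \<mu> - 1) * exp (- t\<^sup>2) * (2 * t)) *
          (\<bar>mpow x a\<bar> * ball_wt \<mu> 1 x))"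
        using True by (simp add: F_def ball_wt_scale mpow_scaleR abs_mult mult_ac)
      also have "\<dots> = ennreal (t ^ mdeg a * t powr (2 * \<mu> - 1) * exp (- t\<^sup>2) * (2 * t)) *
          ennreal (\<bar>mpow x a\<bar> * ball_wt \<mu> 1 x)"
        using True by (intro ennreal_mult') simp
      finally show "F (t *\<^sub>R x) t = \<dots>" .
    qed
    also have "ennreal (t ^ CARD('d)) * (\<integral>\<^sup>+x. \<dots> x \<partial>lborel) =
        C * ennreal (t ^ CARD('d) * (t ^ mdeg a * t powr (2 * \<mu> - 1) * exp (- t\<^sup>2) * (2 * t)))"
    proof -
      have "ennreal a * (ennreal b * C) = C * ennreal (a * b)" if "a \<ge> 0" for a b
        unfolding ennreal_mult'[OF that] by (simp add: mult_ac)
      note comm = this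
      have "(\<integral>\<^sup>+x. ennreal b * ennreal (\<bar>mpow x a\<bar> * ball_wt \<mu> 1 x) \<partial>lborel) = ennreal b * C" for b
        unfolding C_def by (rule nn_integral_cmult) simp
      with comm[of "t ^ CARD('d)"] True show ?thesis by (simp only:) simp
    qed
    also have "t ^ CARD('d) * (t ^ mdeg a * t powr (2 * \<mu> - 1) * exp (- t\<^sup>2) * (2 * t)) =
        t powr p * exp (- t\<^sup>2) * (2 * t) * indicator {0..} t"
    proof -
      have "t powr p = t powr (real (mdeg a) + ((2 * \<mu> - 1) + real CARD('d)))"
        by (simp add: p_def algebra_simps)
      also have "\<dots> = t ^ mdeg a * (t powr (2 * \<mu> - 1) * t ^ CARD('d))"
        using True by (simp only: powr_add powr_realpow)
      finally show ?thesis using True by (simp add: mult_ac)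
    qed
    finally show ?thesis .
  next
    case False
    then have "F x t = 0" for x by (simp add: F_def ball_wt_def mult_nonneg_nonpos ennreal_neg)
    then show ?thesis using False by (auto simp: indicator_def)
  qed
  have "C * ennreal G = (\<integral>\<^sup>+t. \<integral>\<^sup>+x. F x t \<partial>lborel \<partial>lborel)"
    unfolding inner_x G_def by (subst nn_integral_cmult) (use p in \<open>simp_all add: nn_integral_gaussian_powr\<close>)
  also have "\<dots> = (\<integral>\<^sup>+x. \<integral>\<^sup>+t. F x t \<partial>lborel \<partial>lborel)"
    by (rule lborel_pair.Fubini') simp
  also have "\<dots> = ennreal (Gamma (\<mu> + 1 / 2)) * ennreal (\<Prod>i\<in>UNIV. Gamma ((real (a i) + 1) / 2))"
    unfolding inner_t by (subst nn_integral_cmult) (simp_all add: nn_integral_mpow_gaussian)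
  finally have eq: "C * ennreal G = ennreal (Gamma (\<mu> + 1 / 2) * (\<Prod>i\<in>UNIV. Gamma ((real (a i) + 1) / 2)))"
    using mu by (simp add: ennreal_mult' less_imp_le Gamma_real_pos)
  have G: "G > 0" using p by (simp add: G_def Gamma_real_pos)
  have "C = (C * ennreal G) / ennreal G"
    using G by (simp add: ennreal_mult_divide_eq)
  also have "\<dots> = ennreal (Gamma (\<mu> + 1 / 2) * (\<Prod>i\<in>UNIV. Gamma ((real (a i) + 1) / 2)) / G)"
    unfolding eq using G mu by (subst divide_ennreal) (auto intro!: mult_nonneg_nonneg prod_nonneg)
  also have "G = Gamma (real (mdeg a) / 2 + lam \<mu> CARD('d) + 1)"
    by (simp add: G_def p_def lam_def field_simps)
  finally show ?thesis unfolding C_def .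
qed

definition ball_moment :: "real \<Rightarrow> ('d::finite \<Rightarrow> nat) \<Rightarrow> real"
  where "ball_moment \<mu> a = (LINT x|lborel. mpow x a * ball_wt \<mu> 1 x)"

text \<open>The reflection in the i-th coordinate preserves Lebesgue measure and the weight but
  reverses the sign of the integrand. It is written as a diagonal affine map to fit the change of
  variables for \<open>lborel\<close>.\<close>

lemma ball_moment_odd:
  fixes a :: "'d::finite \<Rightarrow> nat"
  assumes "odd (a i)"
  shows "ball_moment \<mu> a = 0"
proof -
  define c where "c j = (if j = axis i 1 then - 1 else 1 :: real)" for j :: "real ^ 'd"
  define T where "T x = 0 + (\<Sum>j\<in>Basis. (c j * (x \<bullet> j)) *\<^sub>R j)" for x
  have c: "c j \<noteq> 0" "\<bar>c j\<bar> = 1" for j by (auto simp: c_def)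
  have T: "T x $ l = (if l = i then - (x $ l) else x $ l)" for x l
  proof -
    have "T x $ l = T x \<bullet> axis l 1" by (simp add: inner_axis)
    also have "\<dots> = c (axis l 1) * (x \<bullet> axis l 1)"
      by (simp add: T_def inner_sum_left inner_Basis if_distrib cong: if_cong)
    finally show ?thesis by (simp add: c_def axis_eq_axis inner_axis)
  qed
  have [measurable]: "T \<in> borel_measurable borel" unfolding T_def by measurable
  have lb: "lborel = distr lborel borel T"
    using lborel_affine_euclidean[of c 0] c by (simp add: T_def[abs_def] density_1)
  have "mpow (T x) a = - mpow x a" for x
  proof -
    have "mpow (T x) a = (- (x $ i)) ^ a i * (\<Prod>l\<in>UNIV - {i}. (x $ l) ^ a l)"
      unfolding mpow_def by (subst prod.remove[of _ i]) (auto simp: T)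
    also have "\<dots> = - mpow x a"
      using assms by (simp add: mpow_def prod.remove[of UNIV i] power_minus_odd)
    finally show ?thesis .
  qed
  moreover have "ball_wt \<mu> 1 (T x) = ball_wt \<mu> 1 x" for x
  proof -
    have "(norm (T x $ l))\<^sup>2 = (norm (x $ l))\<^sup>2" for l by (simp add: T)
    then have "norm (T x) = norm x" by (simp only: norm_vec_def L2_set_def)
    then show ?thesis by (simp add: ball_wt_def)
  qed
  moreover have "ball_moment \<mu> a = (LINT x|lborel. mpow (T x) a * ball_wt \<mu> 1 (T x))"
    unfolding ball_moment_def by (subst lb) (simp add: integral_distr)
  ultimately show ?thesis by (simp add: ball_moment_def)
qed

lemma ball_moment_even:
  fixes a :: "'d::finite \<Rightarrow> nat"
  assumes mu: "\<mu> > - 1 / 2" and lam: "lam \<mu> CARD('d) > 0" and ev: "\<And>i. even (a i)"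
  shows "ball_moment \<mu> a = Gamma (\<mu> + 1 / 2) *
    (\<Prod>i\<in>UNIV. Gamma ((real (a i) + 1) / 2)) / Gamma (real (mdeg a) / 2 + lam \<mu> CARD('d) + 1)"
proof -
  have nonneg: "mpow x a \<ge> 0" for x
    unfolding mpow_def using ev by (intro prod_nonneg) (simp add: zero_le_even_power)
  have "ball_moment \<mu> a = enn2real (\<integral>\<^sup>+x. ennreal (\<bar>mpow x a\<bar> * ball_wt \<mu> 1 x) \<partial>lborel)"
    unfolding ball_moment_def by (subst integral_eq_nn_integral) (auto simp: nonneg ball_wt_nonneg)
  then show ?thesis
    unfolding nn_integral_ball_abs_moment[OF mu] using mu lam
    by (simp add: prod_nonneg)
qed

text \<open>If all exponents are even, Gamma(z+1) = z Gamma(z) in numerator and denominator gives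
  the ratio. Otherwise both sides vanish by parity.\<close>

lemma ball_moment_rec:
  fixes c :: "'d::finite \<Rightarrow> nat"
  assumes mu: "\<mu> > - 1 / 2" and lam: "lam \<mu> CARD('d) > 0" and c: "c i \<ge> 1"
  shows "(real (mdeg c) + 2 * lam \<mu> CARD('d)) * ball_moment \<mu> c
    = (real (c i) - 1) * ball_moment \<mu> (c(i := c i - 2))"
proof (cases "\<forall>l. even (c l)")
  case False
  then obtain l where l: "odd (c l)" by auto
  show ?thesis
  \<comment> \<open>For c_i = 1 truncated subtraction makes the right-hand index even at i, but
    there the factor c_i - 1 is 0.\<close>
  proof (cases "c i = 1")
    case True
    then show ?thesis using ball_moment_odd[of c i] by simp
  next
    case False
    have "odd ((c(i := c i - 2)) l)" using l c False by (cases "l = i") auto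
    from ball_moment_odd[of "c(i := c i - 2)", OF this] ball_moment_odd[of c, OF l] show ?thesis by simp
  qed
next
  case True
  then have ci: "c i \<ge> 2" using c by (metis One_nat_def Suc_1 dvd_1_left le_antisym nat_dvd_1_iff_1 not_less_eq_eq odd_one)
  define c' where "c' = c(i := c i - 2)"
  have ev': "even (c' l)" for l using True by (auto simp: c'_def)
  define P where "P = (\<Prod>l\<in>UNIV - {i}. Gamma ((real (c l) + 1) / 2))"
  have P: "(\<Prod>l\<in>UNIV. Gamma ((real (c l) + 1) / 2)) = Gamma ((real (c i) + 1) / 2) * P"
    "(\<Prod>l\<in>UNIV. Gamma ((real (c' l) + 1) / 2)) = Gamma ((real (c i) - 1) / 2) * P"
    unfolding P_def by (subst prod.remove[of _ i]; use ci in \<open>auto simp: c'_def of_nat_diff\<close>)+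
  have G1: "Gamma ((real (c i) + 1) / 2) = (real (c i) - 1) / 2 * Gamma ((real (c i) - 1) / 2)"
  proof -
    have "(real (c i) - 1) / 2 > 0" using ci by simp
    moreover have "(real (c i) + 1) / 2 = (real (c i) - 1) / 2 + 1" by (simp add: field_simps)
    ultimately show ?thesis by (metis Gamma_plus1 less_irrefl nonpos_Ints_nonpos not_less)
  qed
  define z where "z = real (mdeg c) / 2 + lam \<mu> CARD('d)"
  have z: "z > 0" using lam by (simp add: z_def add_nonneg_pos)
  have "mdeg c' + 2 = mdeg c" using mdeg_fun_upd[of c i "c i - 2"] ci by (simp add: c'_def)
  then have z': "real (mdeg c') / 2 + lam \<mu> CARD('d) + 1 = z" by (simp add: z_def flip: \<open>mdeg c' + 2 = mdeg c\<close>)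
  have Gz: "Gamma (z + 1) = z * Gamma z"
    using z by (metis Gamma_plus1 less_irrefl nonpos_Ints_nonpos not_less)
  have zz: "real (mdeg c) + 2 * lam \<mu> CARD('d) = 2 * z" by (simp add: z_def)
  have "2 * z * (g * (e / 2 * h * P) / (z * y)) = e * (g * (h * P) / y)" for g e h y :: real
    using z by simp
  then show ?thesis
    unfolding ball_moment_even[OF mu lam True[rule_format]] c'_def[symmetric] ball_moment_even[OF mu lam ev']
      P G1 z' zz z_def[symmetric] Gz .
qed

section \<open>Integration over the cone\<close>

text \<open>f itself may be merely Lebesgue measurable; completeness makes it so, as it differs from
  g only on a null set.\<close>

lemma lebesgue_AE_eq_borel:
  fixes f g :: "'a::euclidean_space \<Rightarrow> real"
  assumes [measurable]: "g \<in> borel_measurable borel" and ae: "AE x in lborel. f x = g x"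
  shows "f \<in> borel_measurable lebesgue"
    and "integrable lebesgue f \<longleftrightarrow> integrable lborel g"
    and "integral\<^sup>L lebesgue f = integral\<^sup>L lborel g"
proof -
  have ae': "AE x in lebesgue. f x = g x" by (rule AE_completion[OF ae])
  have g: "g \<in> borel_measurable lebesgue"
    by (rule measurable_completion) simp
  show f: "f \<in> borel_measurable lebesgue"
  proof (rule measurableI)
    fix A :: "real set" assume A: "A \<in> sets borel"
    have "g -` A \<inter> space lebesgue \<in> sets lebesgue" using g A by (rule measurable_sets)
    then show "f -` A \<inter> space lebesgue \<in> sets lebesgue"
      by (rule completion.in_sets_AE[rotated]) (use ae' in auto)
  qed simp
  show "integrable lebesgue f \<longleftrightarrow> integrable lborel g"
    using integrable_cong_AE[OF f g ae'] by (simp add: integrable_completion)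
  show "integral\<^sup>L lebesgue f = integral\<^sup>L lborel g"
    using integral_cong_AE[OF f g ae'] by (simp add: integral_completion)
qed

text \<open>Only the products with powers of t are known to be measurable, so the Borel version is
  taken of t^(d+2mu-1) w(t) rather than of \<open>w\<close>.\<close>

lemma admissible_borel_version:
  assumes w: "admissible_weight d \<mu> w"
  obtains h where "h \<in> borel_measurable borel" "\<And>t. h t \<ge> 0" "\<And>t. t \<le> 0 \<Longrightarrow> h t = 0"
    "AE t in lborel. t > 0 \<longrightarrow> h t = t powr (real d + 2 * \<mu> - 1) * w t"
    "\<And>j. integrable lborel (\<lambda>t. t ^ j * h t)" "(LINT t|lborel. h t) > 0"
proof -
  define m where "m t = indicator {0..} t * (t powr (real d + 2 * \<mu> - 1) * w t)" for t :: real
  have wj: "set_integrable lebesgue {0..} (\<lambda>t. t powr (real d + 2 * \<mu> - 1 + real j) * w t)"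
    "0 < (LINT t:{0..}|lebesgue. t powr (real d + 2 * \<mu> - 1 + real j) * w t)"
    and w0: "t \<ge> 0 \<Longrightarrow> w t \<ge> 0" for j t
    using w unfolding admissible_weight_def Let_def by blast+
  have eq: "indicator {0..} t *\<^sub>R (t powr (real d + 2 * \<mu> - 1 + real j) * w t) = t ^ j * m t" for t j
    by (cases "t > 0") (auto simp: m_def powr_add powr_realpow indicator_def)
  have int_m: "integrable lebesgue (\<lambda>t. t ^ j * m t)" for j
    using wj(1)[of j] unfolding set_integrable_def eq .
  have pos_m: "(LINT t|lebesgue. m t) > 0"
    using wj(2)[of 0] unfolding set_lebesgue_integral_def eq by simp
  have "m \<in> borel_measurable lebesgue" using int_m[of 0] by simp
  from completion_ex_borel_measurable_real[OF this]
  obtain g where g: "g \<in> borel_measurable lborel" "AE t in lborel. m t = g t" by blast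
  \<comment> \<open>The cut at 0 and the maximum turn almost everywhere properties of g into
    pointwise ones without changing its class; the original is 0 at t = 0 because
    \<open>0 powr\<close> is 0.\<close>
  define h where "h t = (if t > 0 then max 0 (g t) else 0)" for t
  have [measurable]: "g \<in> borel_measurable borel" using g(1) by simp
  have h_meas [measurable]: "h \<in> borel_measurable borel" unfolding h_def by measurable
  have mh: "AE t in lborel. m t = h t"
    using g(2)
  proof eventually_elim
    case (elim t)
    have "m t \<ge> 0" by (cases "t \<ge> 0") (simp_all add: m_def w0)
    moreover have "m t = 0" if "t \<le> 0" using that by (cases "t = 0") (auto simp: m_def)
    ultimately show ?case using elim by (auto simp: h_def)
  qed
  show thesis
  proof
    show "AE t in lborel. t > 0 \<longrightarrow> h t = t powr (real d + 2 * \<mu> - 1) * w t"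
      using mh by eventually_elim (auto simp: m_def)
    fix j
    have "AE t in lborel. t ^ j * m t = t ^ j * h t" using mh by eventually_elim simp
    from lebesgue_AE_eq_borel(2)[OF _ this] int_m[of j]
    show "integrable lborel (\<lambda>t. t ^ j * h t)" by simp
    show "(LINT t|lborel. h t) > 0"
      using lebesgue_AE_eq_borel(3)[OF h_meas mh] pos_m by simp
  qed (auto simp: h_def)
qed

lemma AE_lborel_snd:
  assumes "AE t in (lborel :: real measure). P t"
  shows "AE z in (lborel :: ('a::euclidean_space \<times> real) measure). P (snd z)"
proof -
  from assms obtain N where N: "{t. \<not> P t} \<subseteq> N" "N \<in> null_sets lborel"
    by (auto elim!: AE_E simp: null_sets_def)
  have "UNIV \<times> N \<in> null_sets ((lborel :: 'a measure) \<Otimes>\<^sub>M (lborel :: real measure))"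
    using N(2) by (auto simp: null_sets_def lborel.emeasure_pair_measure_Times)
  then have "UNIV \<times> N \<in> null_sets (lborel :: ('a \<times> real) measure)"
    by (simp add: lborel_prod)
  moreover have "{z \<in> space lborel. \<not> P (snd z)} \<subseteq> UNIV \<times> N" using N(1) by auto
  ultimately show ?thesis by (rule AE_I')
qed

text \<open>h plays the role of t^(d+2mu-1) w(t). Its total mass is the zeroth moment of the
  hypothesis, whose positivity is what keeps the inner product from degenerating.\<close>

locale radial_weight =
  fixes h :: "real \<Rightarrow> real" and \<mu> :: real
  assumes mu: "\<mu> > - 1 / 2"
    and h_measurable [measurable]: "h \<in> borel_measurable borel"
    and h_nonneg: "h t \<ge> 0"
    and h_zero: "t \<le> 0 \<Longrightarrow> h t = 0"
    and h_integrable: "integrable lborel (\<lambda>t. t ^ j * h t)"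
    and h_pos: "(LINT t|lborel. h t) > 0"
begin

definition moment :: "nat \<Rightarrow> real"
  where "moment j = (LINT t|lborel. t ^ j * h t)"

text \<open>A Borel version of the cone weight times the indicator of the cone: the negative power
  of t recovers \<open>w\<close> from h.\<close>

definition W :: "(real ^ 'd::finite) \<times> real \<Rightarrow> real"
  where "W = (\<lambda>(x, t). h t * t powr (- (real CARD('d) + 2 * \<mu> - 1)) * ball_wt \<mu> t x)"

lemma W_nonneg: "W z \<ge> 0"
  by (simp add: W_def h_nonneg ball_wt_nonneg split: prod.splits)

lemma W_measurable [measurable]: "(W :: (real ^ 'd::finite) \<times> real \<Rightarrow> real) \<in> borel_measurable borel"
  unfolding W_def borel_prod[symmetric] by measurable

lemma cone_mono_measurable [measurable]:
  "(cone_mono a b :: (real ^ 'd::finite) \<times> real \<Rightarrow> real) \<in> borel_measurable borel"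
  unfolding cone_mono_def borel_prod[symmetric] by measurable

text \<open>The exponents -(d+2mu-1), 2mu-1 and d coming from \<open>W\<close>, the ball weight and
  the volume element add up to 0, so only t^(|a|+b) h(t) remains beside the function of y.\<close>

lemma cone_mono_W_scale:
  fixes y :: "real ^ 'd::finite"
  assumes "t > 0"
  shows "t ^ CARD('d) * (cone_mono a b (t *\<^sub>R y, t) * W (t *\<^sub>R y, t))
    = (t ^ (mdeg a + b) * h t) * (mpow y a * ball_wt \<mu> 1 y)"
proof -
  define \<beta> where "\<beta> = real CARD('d) + 2 * \<mu> - 1"
  have "t powr (- \<beta>) * t powr (2 * \<mu> - 1) * t ^ CARD('d) = t powr (- \<beta> + (2 * \<mu> - 1) + real CARD('d))"
    using assms by (simp only: powr_add powr_realpow)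
  also have "\<dots> = 1" using assms by (simp add: \<beta>_def)
  finally have 1: "t powr (- \<beta>) * t powr (2 * \<mu> - 1) * t ^ CARD('d) = 1" .
  have "t ^ CARD('d) * (cone_mono a b (t *\<^sub>R y, t) * W (t *\<^sub>R y, t))
    = (t powr (- \<beta>) * t powr (2 * \<mu> - 1) * t ^ CARD('d)) *
      ((t ^ (mdeg a + b) * h t) * (mpow y a * ball_wt \<mu> 1 y))"
    unfolding W_def cone_mono_def prod.case ball_wt_scale[OF assms] mpow_scaleR power_add \<beta>_def[symmetric]
    by (simp only: mult_ac)
  then show ?thesis unfolding 1 by simp
qed

text \<open>Fubini, with x = t y in each slice. The absolute moments are handled first, since
  finiteness is needed before the signed integral may be split.\<close>

lemma W_moment:
  fixes a :: "'d::finite \<Rightarrow> nat"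
  shows "integrable lborel (\<lambda>z. cone_mono a b z * W z)"
    and "(LINT z|lborel. cone_mono a b z * W z) = ball_moment \<mu> a * moment (mdeg a + b)"
proof -
  let ?d = "CARD('d)"
  let ?G = "\<lambda>x t. cone_mono a b (x, t) * W (x, t)"
  define A where "A = (\<integral>\<^sup>+x. ennreal (\<bar>mpow x a\<bar> * ball_wt \<mu> 1 x) \<partial>lborel)"
  have A: "A < \<infinity>" unfolding A_def nn_integral_ball_abs_moment[OF mu] by simp
  have meas: "(\<lambda>x. ?G x t) \<in> borel_measurable borel" for t
    by (simp add: W_def cone_mono_def)
  have inner: "(\<integral>\<^sup>+x. ennreal \<bar>?G x t\<bar> \<partial>lborel) = A * ennreal (norm (t ^ (mdeg a + b) * h t))" for t
  proof (cases "t > 0")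
    case True
    define s where "s = norm (t ^ (mdeg a + b) * h t)"
    have "(\<integral>\<^sup>+x. ennreal \<bar>?G x t\<bar> \<partial>lborel) = ennreal (t ^ ?d) * (\<integral>\<^sup>+x. ennreal \<bar>?G (t *\<^sub>R x) t\<bar> \<partial>lborel)"
      using nn_integral_scale[of "\<lambda>x. ennreal \<bar>?G x t\<bar>" t] True meas by simp
    also have "\<dots> = (\<integral>\<^sup>+x. ennreal (t ^ ?d) * ennreal \<bar>?G (t *\<^sub>R x) t\<bar> \<partial>lborel)"
      by (rule nn_integral_cmult[symmetric]) (simp add: W_def cone_mono_def)
    also have "\<dots> = (\<integral>\<^sup>+x. ennreal s * ennreal (\<bar>mpow x a\<bar> * ball_wt \<mu> 1 x) \<partial>lborel)"
    proof (intro nn_integral_cong)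
      fix x
      have "t ^ ?d * \<bar>?G (t *\<^sub>R x) t\<bar> = \<bar>t ^ ?d * ?G (t *\<^sub>R x) t\<bar>" using True by (simp add: abs_mult)
      also have "\<dots> = s * (\<bar>mpow x a\<bar> * ball_wt \<mu> 1 x)"
        unfolding cone_mono_W_scale[OF True] s_def by (simp add: abs_mult ball_wt_nonneg)
      finally show "ennreal (t ^ ?d) * ennreal \<bar>?G (t *\<^sub>R x) t\<bar> = ennreal s * ennreal (\<bar>mpow x a\<bar> * ball_wt \<mu> 1 x)"
        using True by (metis ennreal_mult' norm_ge_zero s_def zero_le_power less_imp_le)
    qed
    also have "\<dots> = ennreal s * A"
      unfolding A_def by (rule nn_integral_cmult) simp
    finally show ?thesis by (simp add: s_def mult.commute)
  qed (simp add: W_def h_zero)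
  have "(\<integral>\<^sup>+z. ennreal (norm (cone_mono a b z * W z)) \<partial>lborel)
      = (\<integral>\<^sup>+t. \<integral>\<^sup>+x. ennreal \<bar>?G x t\<bar> \<partial>lborel \<partial>lborel)"
    using lborel_pair.nn_integral_snd[of "\<lambda>z. ennreal \<bar>cone_mono a b z * W z\<bar>"]
    by (simp add: lborel_prod)
  also have "\<dots> = A * (\<integral>\<^sup>+t. ennreal (norm (t ^ (mdeg a + b) * h t)) \<partial>lborel)"
    unfolding inner by (rule nn_integral_cmult) simp
  also have "\<dots> < \<infinity>"
    using h_integrable[of "mdeg a + b"] A by (simp add: integrable_iff_bounded ennreal_mult_less_top)
  finally show int: "integrable lborel (\<lambda>z. cone_mono a b z * W z)"
    by (simp add: integrable_iff_bounded)
  have innerL: "(LINT x|lborel. ?G x t) = ball_moment \<mu> a * (t ^ (mdeg a + b) * h t)" for t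
  proof (cases "t > 0")
    case True
    have "(LINT x|lborel. ?G x t) = (LINT x|lborel. t ^ ?d * ?G (t *\<^sub>R x) t)"
      using integral_scale[of "\<lambda>x. ?G x t" t] True meas by simp
    then show ?thesis
      unfolding cone_mono_W_scale[OF True] by (simp add: ball_moment_def)
  qed (simp add: W_def h_zero)
  have "(LINT z|lborel. cone_mono a b z * W z) = (LINT t|lborel. LINT x|lborel. ?G x t)"
    using lborel_pair.integral_snd[of ?G] int unfolding lborel_prod by (simp add: case_prod_beta')
  also have "\<dots> = ball_moment \<mu> a * moment (mdeg a + b)"
    unfolding innerL moment_def by simp
  finally show "(LINT z|lborel. cone_mono a b z * W z) = ball_moment \<mu> a * moment (mdeg a + b)" .
qed

end

section \<open>Monic orthogonal polynomials\<close>

text \<open>Gram-Schmidt gives existence. Two solutions differ by some e of lower degree, orthogonal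
  to both, so L(e e) = 0 and e = 0.\<close>

lemma monic_orthogonal_ex1:
  fixes L :: "real poly \<Rightarrow> real"
  assumes add: "\<And>p q. L (p + q) = L p + L q" and smult: "\<And>c p. L (smult c p) = c * L p"
    and pos: "\<And>p. p \<noteq> 0 \<Longrightarrow> L (p * p) > 0"
  shows "\<exists>!p. degree p = j \<and> lead_coeff p = 1 \<and> (\<forall>r. degree r < j \<longrightarrow> L (p * r) = 0)"
proof -
  let ?Q = "\<lambda>j p. degree p = j \<and> lead_coeff p = 1 \<and> (\<forall>r. degree r < j \<longrightarrow> L (p * r) = 0)"
  have zero: "L 0 = 0" using smult[of 0 0] by simp
  have diff: "L (p - q) = L p - L q" for p q
    using add[of p "smult (- 1) q"] smult[of "- 1" q] by simp
  have sum: "L (\<Sum>i\<in>I. f i) = (\<Sum>i\<in>I. L (f i))" if "finite I" for f :: "nat \<Rightarrow> real poly" and I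
    using that by (induction I rule: finite_induct) (auto simp: zero add)
  have ex: "\<exists>p. ?Q j p" for j
  proof (induction j rule: less_induct)
    case (less j)
    then obtain P where P: "\<And>i. i < j \<Longrightarrow> ?Q i (P i)" by metis
    have P0: "P i \<noteq> 0" if "i < j" for i using P[OF that] by auto
    define c where "c i = L (monom 1 j * P i) / L (P i * P i)" for i
    define S where "S = (\<Sum>i<j. smult (c i) (P i))"
    define p where "p = monom 1 j - S"
    \<comment> \<open>For j = 0 the sum is empty and no degree is below 0, hence the separate
      alternative.\<close>
    have S: "S = 0 \<or> degree S < j"
    proof (cases "j = 0")
      case False
      then have "degree S < j" unfolding S_def
        by (intro degree_sum_less) (auto simp: P degree_smult_le intro: le_less_trans[OF degree_smult_le])
      then show ?thesis ..
    qed (simp add: S_def)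
    then have cS: "coeff S j = 0" by (auto simp: coeff_eq_0)
    have "degree p \<le> j" unfolding p_def using S by (intro degree_diff_le) (auto simp: degree_monom_le)
    moreover have cp: "coeff p j = 1" by (simp add: p_def cS)
    ultimately have deg: "degree p = j" by (metis le_antisym le_degree zero_neq_one)
    have orthP: "L (p * P i) = 0" if i: "i < j" for i
    proof -
      have "L (S * P i) = (\<Sum>l<j. c l * L (P l * P i))"
        by (simp add: S_def sum_distrib_right sum smult)
      also have "\<dots> = (\<Sum>l<j. if l = i then L (monom 1 j * P i) else 0)"
      proof (intro sum.cong refl)
        fix l assume l: "l \<in> {..<j}"
        show "c l * L (P l * P i) = (if l = i then L (monom 1 j * P i) else 0)"
        proof (cases "l = i")
          case True
          then show ?thesis using pos[OF P0[OF i]] by (simp add: c_def)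
        next
          case False
          then have "L (P l * P i) = 0"
          proof (cases "l < i")
            case True
            then have "L (P i * P l) = 0" using P[OF i] P[of l] i by auto
            then show ?thesis by (simp add: mult.commute)
          next
            case False
            then show ?thesis using \<open>l \<noteq> i\<close> P[of l] P[OF i] l by auto
          qed
          then show ?thesis using False by simp
        qed
      qed
      also have "\<dots> = L (monom 1 j * P i)" using i by simp
      finally show ?thesis by (simp add: p_def left_diff_distrib diff)
    qed
    \<comment> \<open>Subtracting the right multiple of the monic P_m, m = deg r, kills the top
      coefficient; the induction lowers the degree or reaches 0.\<close>
    have "L (p * r) = 0" if "degree r < j" for r
      using that
    proof (induction "degree r" arbitrary: r rule: less_induct)
      case (less r)
      define m where "m = degree r"
      define r' where "r' = r - smult (lead_coeff r) (P m)"
      have m: "m < j" using less.prems by (simp add: m_def)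
      have r: "L (p * r) = L (p * r') + lead_coeff r * L (p * P m)"
        by (simp add: r'_def right_diff_distrib diff smult)
      have c0: "coeff r' m = 0" using P[OF m] by (auto simp: r'_def m_def)
      have d: "degree r' \<le> m" unfolding r'_def
        by (intro degree_diff_le) (auto simp: m_def[symmetric] P[OF m] intro: order_trans[OF degree_smult_le])
      have "L (p * r') = 0"
      proof (cases "r' = 0")
        case False
        then have "degree r' \<noteq> m" using c0 by auto
        then have "degree r' < m" using d by simp
        then show ?thesis using less.hyps[of r'] m by (simp add: m_def)
      qed (simp add: zero)
      then show ?case using r orthP[OF m] by simp
    qed
    then show ?case using deg cp by auto
  qed
  then obtain p where p: "?Q j p" by blast
  show ?thesis
  proof (rule ex1I[of "?Q j" p, OF p])
    fix q assume q: "?Q j q"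
    show "q = p"
    proof (rule ccontr)
      assume ne: "q \<noteq> p"
      define e where "e = q - p"
      have "degree e \<le> j" using p q unfolding e_def by (intro degree_diff_le) auto
      moreover have "coeff e j = 0" using p q unfolding e_def coeff_diff by (metis diff_self)
      moreover have "e \<noteq> 0" using ne by (simp add: e_def)
      ultimately have "degree e < j" by (metis le_neq_implies_less leading_coeff_0_iff)
      then have "L (q * e) = 0" "L (p * e) = 0" using p q by auto
      then have "L (e * e) = 0" by (simp add: e_def left_diff_distrib diff)
      then show False using pos[of e] \<open>e \<noteq> 0\<close> by simp
    qed
  qed
qed

lemma AE_lborel_finite:
  "finite A \<Longrightarrow> AE x in lborel. (x :: 'a::euclidean_space) \<notin> A"
  by (intro AE_not_in) (auto simp: finite_imp_null_set_lborel)

section \<open>Radial orthogonal polynomials, and the passage from \<open>w\<close> to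
  \<open>h\<close>\<close>

context radial_weight
begin

text \<open>Since alpha_m = 2m + (d+2mu-1), the density t^(2m) h is the one belonging to t^alpha_m
  w.\<close>

definition poly_functional :: "nat \<Rightarrow> real poly \<Rightarrow> real"
  where "poly_functional m p = (LINT t|lborel. poly p t * (t ^ (2 * m) * h t))"

lemma poly_h_integrable: "integrable lborel (\<lambda>t. poly p t * (t ^ m * h t))"
proof -
  have "(\<lambda>t. poly p t * (t ^ m * h t)) = (\<lambda>t. \<Sum>i\<le>degree p. coeff p i * (t ^ (i + m) * h t))"
    by (simp add: fun_eq_iff poly_altdef sum_distrib_right power_add mult.assoc)
  then show ?thesis using h_integrable by simp
qed

lemma poly_functional_moment:
  "poly_functional m p = (\<Sum>i\<le>degree p. coeff p i * moment (i + 2 * m))"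
proof -
  have "(\<lambda>t. poly p t * (t ^ (2 * m) * h t)) = (\<lambda>t. \<Sum>i\<le>degree p. coeff p i * (t ^ (i + 2 * m) * h t))"
    by (simp add: fun_eq_iff poly_altdef sum_distrib_right power_add mult.assoc)
  then show ?thesis using h_integrable by (simp add: poly_functional_def moment_def)
qed

lemma h_not_AE_zero: "\<not> (AE t in lborel. h t = 0)"
proof
  assume "AE t in lborel. h t = 0"
  then have "(LINT t|lborel. h t) = 0" by (intro integral_eq_zero_AE)
  then show False using h_pos by simp
qed

lemma poly_functional_pos:
  assumes "p \<noteq> 0"
  shows "poly_functional m (p * p) > 0"
proof -
  have nonneg: "poly (p * p) t * (t ^ (2 * m) * h t) \<ge> 0" for t
    by (simp add: h_nonneg power_mult)
  have "poly_functional m (p * p) \<noteq> 0"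
  proof
    assume "poly_functional m (p * p) = 0"
    then have ae: "AE t in lborel. poly (p * p) t * (t ^ (2 * m) * h t) = 0"
      unfolding poly_functional_def
      using integral_nonneg_eq_0_iff_AE[OF poly_h_integrable[of "p * p" "2 * m"]] nonneg by simp
    \<comment> \<open>The point 0 joins the roots of p because t^(2m) may vanish there.\<close>
    have "finite (insert 0 {t. poly p t = 0})" using assms by (simp add: poly_roots_finite)
    from AE_lborel_finite[OF this] ae have "AE t in lborel. h t = 0"
      by eventually_elim auto
    then show False using h_not_AE_zero by simp
  qed
  moreover have "poly_functional m (p * p) \<ge> 0"
    unfolding poly_functional_def by (rule integral_nonneg_AE) (simp only: nonneg AE_I2)
  ultimately show ?thesis by simp
qed

lemma poly_functional_linear:
  "poly_functional m (p + q) = poly_functional m p + poly_functional m q"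
  "poly_functional m (smult c p) = c * poly_functional m p"
  unfolding poly_functional_def using poly_h_integrable[of p "2 * m"] poly_h_integrable[of q "2 * m"]
  by (simp_all add: distrib_right mult.assoc)

definition radial_op :: "nat \<Rightarrow> nat \<Rightarrow> real poly"
  where "radial_op m j = (THE p. degree p = j \<and> lead_coeff p = 1 \<and>
    (\<forall>r. degree r < j \<longrightarrow> poly_functional m (p * r) = 0))"

lemma radial_op:
  "degree (radial_op m j) = j" "lead_coeff (radial_op m j) = 1"
  "degree r < j \<Longrightarrow> poly_functional m (radial_op m j * r) = 0"
  using theI'[OF monic_orthogonal_ex1[of "poly_functional m" j,
    OF poly_functional_linear poly_functional_pos], folded radial_op_def] by blast+

end

text \<open>The bridge to the stated objects: \<open>monic_op\<close> and \<open>radial_op\<close>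
  are defined by the same property of equal functionals, and the cone weight cut off to the cone
  equals \<open>W\<close> almost everywhere.\<close>

lemma admissible_transfer:
  fixes w :: "real \<Rightarrow> real"
  assumes mu: "\<mu> > - 1 / 2" and w: "admissible_weight CARD('d::finite) \<mu> w"
  obtains h where "radial_weight h \<mu>"
    "\<And>m j. monic_op w (2 * real m + 2 * \<mu> + real CARD('d) - 1) j = radial_weight.radial_op h m j"
    "\<And>f g :: (real ^ 'd) \<times> real \<Rightarrow> real. (\<lambda>z. f z * g z) \<in> borel_measurable borel \<Longrightarrow>
       cone_inner w \<mu> f g = (LINT z|lborel. f z * g z * radial_weight.W h \<mu> z)"
proof -
  define \<beta> where "\<beta> = real CARD('d) + 2 * \<mu> - 1"
  from admissible_borel_version[OF w] obtain h where
    h: "h \<in> borel_measurable borel" "\<And>t. h t \<ge> 0" "\<And>t. t \<le> 0 \<Longrightarrow> h t = 0"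
    and ae: "AE t in lborel. t > 0 \<longrightarrow> h t = t powr \<beta> * w t"
    and hi: "\<And>j. integrable lborel (\<lambda>t. t ^ j * h t)" "(LINT t|lborel. h t) > 0"
    unfolding \<beta>_def by blast
  interpret radial_weight h \<mu>
    using mu h hi by unfold_locales auto
  show thesis
  proof
    show "radial_weight h \<mu>" by unfold_locales
  next
    fix m j
    have "(LINT t:{0..}|lebesgue. poly p t * poly r t * (t powr (2 * real m + 2 * \<mu> + real CARD('d) - 1) * w t))
        = poly_functional m (p * r)" for p r
      unfolding set_lebesgue_integral_def poly_functional_def
    proof (rule lebesgue_AE_eq_borel(3))
      have \<alpha>: "2 * real m + 2 * \<mu> + real CARD('d) - 1 = real (2 * m) + \<beta>" by (simp add: \<beta>_def)
      show "AE t in lborel. indicator {0..} t *\<^sub>R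
          (poly p t * poly r t * (t powr (2 * real m + 2 * \<mu> + real CARD('d) - 1) * w t)) =
        poly (p * r) t * (t ^ (2 * m) * h t)"
        using ae unfolding \<alpha>
      proof eventually_elim
        case (elim t)
        show ?case
        proof (cases "t > 0")
          case True
          then have "t powr (real (2 * m) + \<beta>) = t ^ (2 * m) * t powr \<beta>"
            by (simp only: powr_add powr_realpow)
          then show ?thesis using True elim by simp
        qed (auto simp: h indicator_def)
      qed
    qed (use borel_measurable_integrable[OF poly_h_integrable[of "p * r" "2 * m"]] in simp)
    then show "monic_op w (2 * real m + 2 * \<mu> + real CARD('d) - 1) j = radial_op m j"
      by (simp add: monic_op_def radial_op_def)
  next
    fix f g :: "(real ^ 'd) \<times> real \<Rightarrow> real"
    assume [measurable]: "(\<lambda>z. f z * g z) \<in> borel_measurable borel"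
    show "cone_inner w \<mu> f g = (LINT z|lborel. f z * g z * W z)"
      unfolding cone_inner_def set_lebesgue_integral_def
    proof (rule lebesgue_AE_eq_borel(3))
      show "(\<lambda>z. f z * g z * W z) \<in> borel_measurable borel" by measurable
      show "AE z in lborel. indicator cone z *\<^sub>R (f z * g z * cone_weight_fun w \<mu> z) = f z * g z * W z"
        using AE_lborel_snd[OF ae]
      proof eventually_elim
        case (elim z)
        obtain x t where z: "z = (x, t)" by fastforce
        have "indicator cone z * cone_weight_fun w \<mu> z = W z"
        proof (cases "t > 0")
          case True
          have "h t * t powr (- \<beta>) = w t * (t powr \<beta> * t powr (- \<beta>))" using elim True z by simp
          also have "\<dots> = w t" using True by (simp flip: powr_add)
          finally have wt: "h t * t powr (- \<beta>) = w t" .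
          have "W z = w t * ball_wt \<mu> t x" unfolding W_def z by (simp add: wt flip: \<beta>_def)
          then show ?thesis using True by (simp add: z cone_def cone_weight_fun_def ball_wt_def)
        next
          case False
          \<comment> \<open>Below height 0 there is no cone; at height 0 only the apex, where the
            weight is \<open>0 powr\<close>, hence 0.\<close>
          have "indicator cone z * cone_weight_fun w \<mu> z = 0"
          proof (cases "t = 0")
            case True
            then show ?thesis by (auto simp: z cone_def cone_weight_fun_def)
          qed (use False in \<open>simp add: z cone_def\<close>)
          then show ?thesis using False by (simp add: z W_def h)
        qed
        then show ?case by (metis mult.left_commute real_scaleR_def)
      qed
    qed
  qed
qed

section \<open>Polynomial functions on the cone\<close>

lemma mpow_add: "mpow x (\<lambda>i. a i + b i) = mpow x a * mpow x b"
  by (simp add: mpow_def power_add prod.distrib)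

lemma cone_mono_mult:
  "cone_mono a b z * cone_mono a' b' z = cone_mono (\<lambda>i. a i + a' i) (b + b') z"
  by (simp add: cone_mono_def mpow_add power_add split: prod.splits)

lemma cone_mono_in_polys_le: "int (mdeg k + j) \<le> N \<Longrightarrow> cone_mono k j \<in> polys_le N"
  unfolding polys_le_def by (rule fn.span_base) blast

lemma polys_le_add: "f \<in> polys_le N \<Longrightarrow> g \<in> polys_le N \<Longrightarrow> (\<lambda>z. f z + g z) \<in> polys_le N"
  unfolding polys_le_def using fn.span_add by (fastforce simp: plus_fun_def)

lemma polys_le_diff: "f \<in> polys_le N \<Longrightarrow> g \<in> polys_le N \<Longrightarrow> f - g \<in> polys_le N"
  unfolding polys_le_def by (rule fn.span_diff)

lemma polys_le_cmult: "f \<in> polys_le N \<Longrightarrow> (\<lambda>z. c * f z) \<in> polys_le N"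
  unfolding polys_le_def by (rule fn.span_scale)

lemma sum_fun_eq: "(\<Sum>i\<in>I. f i) = (\<lambda>z. \<Sum>i\<in>I. f i z)"
  by (induction I rule: infinite_finite_induct) (auto simp: fun_eq_iff)

lemma polys_le_sum: "(\<And>i. i \<in> I \<Longrightarrow> f i \<in> polys_le N) \<Longrightarrow> (\<lambda>z. \<Sum>i\<in>I. f i z) \<in> polys_le N"
  unfolding polys_le_def sum_fun_eq[symmetric] by (rule fn.span_sum)

lemma polys_le_zero: "0 \<in> polys_le N"
  unfolding polys_le_def by (rule fn.span_zero)

lemma polys_le_induct [consumes 1, case_names mono zero add cmult]:
  assumes "f \<in> polys_le N"
    and "\<And>k j. int (mdeg k + j) \<le> N \<Longrightarrow> P (cone_mono k j)"
    and "P (\<lambda>z. 0)" "\<And>f g. P f \<Longrightarrow> P g \<Longrightarrow> P (\<lambda>z. f z + g z)" "\<And>c f. P f \<Longrightarrow> P (\<lambda>z. c * f z)"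
  shows "P f"
  using assms(1) unfolding polys_le_def
proof (induction f rule: fn.span_induct)
  case base
  show ?case using assms(3-5) unfolding fn.subspace_def by (auto simp: plus_fun_def zero_fun_def)
qed (use assms(2) in blast)

lemma polys_le_mult:
  assumes f: "f \<in> polys_le M" and g: "g \<in> polys_le N"
  shows "(\<lambda>z. f z * g z) \<in> polys_le (M + N)"
  using f
proof (induction f rule: polys_le_induct)
  case (mono k j)
  show ?case using g
  proof (induction g rule: polys_le_induct)
    case (mono k' j')
    have "cone_mono (\<lambda>i. k i + k' i) (j + j') \<in> polys_le (M + N)"
      using mono \<open>int (mdeg k + j) \<le> M\<close> by (intro cone_mono_in_polys_le) (simp add: mdeg_add)
    then show ?case by (simp add: cone_mono_mult)
  next
    case (cmult c f)
    from polys_le_cmult[OF this, of c] show ?case by (simp add: mult.left_commute)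
  qed (use polys_le_add polys_le_zero in \<open>simp_all add: distrib_left zero_fun_def\<close>)
next
  case (cmult c f)
  from polys_le_cmult[OF this, of c] show ?case by (simp add: mult.assoc)
qed (use polys_le_add polys_le_zero in \<open>simp_all add: distrib_right zero_fun_def\<close>)

lemma polys_le_continuous: "f \<in> polys_le N \<Longrightarrow> continuous_on UNIV f"
proof (induction f rule: polys_le_induct)
  case (mono k j)
  show ?case unfolding cone_mono_def mpow_def case_prod_beta' by (intro continuous_intros)
qed (auto intro: continuous_intros)

lemma polys_le_measurable: "f \<in> polys_le N \<Longrightarrow> f \<in> borel_measurable borel"
  by (intro borel_measurable_continuous_onI polys_le_continuous)

section \<open>Restriction to lines and rays, and independence of leading forms\<close>

lemma polys_le_line:
  assumes "f \<in> polys_le N"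
  obtains p where "\<And>s. f (z + s *\<^sub>R v) = poly p s"
proof -
  have "\<exists>p. \<forall>s. f (z + s *\<^sub>R v) = poly p s"
    using assms
  proof (induction f rule: polys_le_induct)
    case (mono k j)
    show ?case
      by (rule exI[of _ "[:snd z, snd v:] ^ j * (\<Prod>i\<in>UNIV. [:fst z $ i, fst v $ i:] ^ k i)"])
         (simp add: cone_mono_def case_prod_beta' mpow_def poly_prod)
  next
    case zero
    show ?case by (rule exI[of _ 0]) simp
  next
    case (add f g)
    then obtain p q where "\<And>s. f (z + s *\<^sub>R v) = poly p s" "\<And>s. g (z + s *\<^sub>R v) = poly q s" by blast
    then show ?case by (intro exI[of _ "p + q"]) simp
  next
    case (cmult c f)
    then obtain p where "\<And>s. f (z + s *\<^sub>R v) = poly p s" by blast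
    then show ?case by (intro exI[of _ "smult c p"]) simp
  qed
  then show thesis using that by blast
qed

lemma cone_mono_scaleR: "cone_mono k j (s *\<^sub>R z) = s ^ (mdeg k + j) * cone_mono k j z"
  by (simp add: cone_mono_def case_prod_beta' mpow_scaleR power_add power_mult_distrib)

lemma polys_le_ray:
  assumes "f \<in> polys_le N"
  obtains p where "\<And>s. f (s *\<^sub>R z) = poly p s" "\<And>i. int i > N \<Longrightarrow> coeff p i = 0"
proof -
  have "\<exists>p. (\<forall>s. f (s *\<^sub>R z) = poly p s) \<and> (\<forall>i. int i > N \<longrightarrow> coeff p i = 0)"
    using assms
  proof (induction f rule: polys_le_induct)
    case (mono k j)
    then show ?case
      by (intro exI[of _ "monom (cone_mono k j z) (mdeg k + j)"])
         (auto simp: cone_mono_scaleR poly_monom)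
  next
    case zero
    show ?case by (rule exI[of _ 0]) simp
  next
    case (add f g)
    then obtain p q where "\<And>s. f (s *\<^sub>R z) = poly p s" "\<And>s. g (s *\<^sub>R z) = poly q s"
      "\<And>i. int i > N \<Longrightarrow> coeff p i = 0" "\<And>i. int i > N \<Longrightarrow> coeff q i = 0" by blast
    then show ?case by (intro exI[of _ "p + q"]) simp
  next
    case (cmult c f)
    then obtain p where "\<And>s. f (s *\<^sub>R z) = poly p s" "\<And>i. int i > N \<Longrightarrow> coeff p i = 0" by blast
    then show ?case by (intro exI[of _ "smult c p"]) simp
  qed
  then show thesis using that by blast
qed

text \<open>On the line joining z0 to an arbitrary z, f is a polynomial in one variable with
  infinitely many zeros near z0, hence 0 also at z.\<close>

lemma polys_le_zero_on_open:
  assumes f: "f \<in> polys_le N" and U: "open U" "z0 \<in> U" and zero: "\<And>z. z \<in> U \<Longrightarrow> f z = 0"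
  shows "f = 0"
proof
  fix z
  obtain p where p: "\<And>s. f (z0 + s *\<^sub>R (z - z0)) = poly p s" using polys_le_line[OF f] by blast
  obtain e where e: "e > 0" "ball z0 e \<subseteq> U" using U by (meson openE)
  \<comment> \<open>The added 1 keeps the quotient meaningful when z = z0.\<close>
  define \<delta> where "\<delta> = e / (norm (z - z0) + 1)"
  have \<delta>: "\<delta> > 0" using e by (simp add: \<delta>_def add_nonneg_pos)
  have "poly p s = 0" if s: "s \<in> {0<..<\<delta>}" for s
  proof -
    have "dist z0 (z0 + s *\<^sub>R (z - z0)) = s * norm (z - z0)" using s by (simp add: dist_norm)
    also have "\<dots> \<le> \<delta> * norm (z - z0)" using s by (intro mult_right_mono) auto
    also have "\<dots> < e" 
    proof -
      have "norm (z - z0) + 1 > 0" by (simp add: add_nonneg_pos)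
      moreover have "e * norm (z - z0) < e * (norm (z - z0) + 1)" using e(1) by simp
      ultimately show ?thesis unfolding \<delta>_def by (simp only: times_divide_eq_left pos_divide_less_eq)
    qed
    finally show ?thesis using e zero p by (metis mem_ball subsetD)
  qed
  then have "{0<..<\<delta>} \<subseteq> {s. poly p s = 0}" by auto
  moreover have "infinite {0<..<\<delta>}" using \<delta> by (simp add: infinite_Ioo)
  ultimately have "p = 0" using poly_roots_finite finite_subset by blast
  then show "f z = 0 z" using p[of 1] by simp
qed

text \<open>Induction on the set I of active variables. Exponents are 0 outside I, so a multi-index
  is determined by its restriction to I.\<close>

lemma mpow_independent_aux:
  fixes c :: "('d::finite \<Rightarrow> nat) \<Rightarrow> real"
  assumes "finite I" "finite S" "\<And>k i. k \<in> S \<Longrightarrow> i \<notin> I \<Longrightarrow> k i = 0"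
    and "\<And>x :: 'd \<Rightarrow> real. (\<Sum>k\<in>S. c k * (\<Prod>i\<in>I. x i ^ k i)) = 0" and "k \<in> S"
  shows "c k = 0"
  using assms
proof (induction I arbitrary: S c k rule: finite_induct)
  case empty
  have all0: "l = (\<lambda>_. 0)" if "l \<in> S" for l using empty(2)[OF that] by auto
  then have "S = {k}" using empty(4) by blast
  then show ?case using empty(3) by simp
next
  case (insert i I)
  define m where "m = k i"
  define S1 where "S1 = {l \<in> S. l i = m}"
  have S1: "finite S1" using insert.prems(1) by (simp add: S1_def)
  have z1: "(\<Sum>l\<in>S1. c l * (\<Prod>j\<in>I. x j ^ l j)) = 0" for x
  proof -
    \<comment> \<open>The sum read as a polynomial in the i-th variable alone; its m-th coefficient
      isolates the terms with exponent m there.\<close>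
    define P where "P = (\<Sum>l\<in>S. monom (c l * (\<Prod>j\<in>I. x j ^ l j)) (l i))"
    have "poly P u = 0" for u
    proof -
      have "(\<Prod>j\<in>I. (x(i := u)) j ^ l j) = (\<Prod>j\<in>I. x j ^ l j)" for l
        using insert.hyps by (intro prod.cong) auto
      with insert.prems(3)[of "x(i := u)"] show ?thesis
        using insert.hyps by (simp add: P_def poly_sum poly_monom mult_ac)
    qed
    then have "P = 0" by (simp add: poly_all_0_iff_0[symmetric])
    then have "coeff P m = 0" by simp
    then show ?thesis
      unfolding P_def S1_def coeff_sum using insert.prems(1)
      by (subst sum.inter_filter) (simp_all add: if_distrib cong: if_cong)
  qed
  \<comment> \<open>Erasing the exponent at i is injective on \<open>S1\<close>, where that exponent
    is constantly m, and it restores the support condition for I.\<close>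
  define r where "r l = l(i := 0)" for l :: "'d \<Rightarrow> nat"
  define c' where "c' l = c (l(i := m))" for l
  have inj: "inj_on r S1"
  proof (rule inj_onI)
    fix l l' assume "l \<in> S1" "l' \<in> S1" and eq: "r l = r l'"
    then have "l i = l' i" by (simp add: S1_def)
    moreover have "l j = l' j" if "j \<noteq> i" for j
      using fun_cong[OF eq, of j] that by (simp add: r_def)
    ultimately show "l = l'" by (metis ext)
  qed
  have c'r: "c' (r l) = c l" if "l \<in> S1" for l
    using that by (auto simp: c'_def r_def S1_def intro!: arg_cong[of _ _ c])
  have "c' (r k) = 0"
  proof (rule insert.IH)
    show "finite (r ` S1)" using S1 by simp
    show "l j = 0" if "l \<in> r ` S1" "j \<notin> I" for l j
      using that insert.prems(2) by (auto simp: r_def S1_def)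
    show "r k \<in> r ` S1" using insert.prems(4) by (simp add: S1_def m_def)
    show "(\<Sum>l\<in>r ` S1. c' l * (\<Prod>j\<in>I. x j ^ l j)) = 0" for x
    proof -
      have "(\<Prod>j\<in>I. x j ^ r l j) = (\<Prod>j\<in>I. x j ^ l j)" for l
        using insert.hyps by (intro prod.cong) (auto simp: r_def)
      then show ?thesis using z1[of x] by (simp add: sum.reindex[OF inj] c'r)
    qed
  qed
  then show ?case using c'r[of k] insert.prems(4) by (simp add: S1_def m_def)
qed

lemma mpow_independent:
  fixes c :: "('d::finite \<Rightarrow> nat) \<Rightarrow> real"
  assumes "finite S" "\<And>x. (\<Sum>k\<in>S. c k * mpow x k) = 0" "k \<in> S"
  shows "c k = 0"
proof (rule mpow_independent_aux[of UNIV S c k])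
  show "(\<Sum>k\<in>S. c k * (\<Prod>i\<in>UNIV. x i ^ k i)) = 0" for x
    using assms(2)[of "\<chi> i. x i"] by (simp add: mpow_def)
qed (use assms in auto)

lemma finite_mdeg_le: "finite {k :: 'd::finite \<Rightarrow> nat. mdeg k \<le> n}"
proof (rule finite_subset)
  show "{k :: 'd \<Rightarrow> nat. mdeg k \<le> n} \<subseteq> PiE UNIV (\<lambda>_. {..n})"
  proof
    fix k :: "'d \<Rightarrow> nat" assume "k \<in> {k. mdeg k \<le> n}"
    then have "k i \<le> n" for i using member_le_sum[of i UNIV k] by (simp add: mdeg_def)
    then show "k \<in> PiE UNIV (\<lambda>_. {..n})" by auto
  qed
qed (simp add: finite_PiE)

text \<open>Along a ray a form of degree \<open>n\<close> is \<open>s\<^sup>n\<close> times a constant, a lower polynomial has degree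
  below \<open>n\<close> in \<open>s\<close>.\<close>

lemma leading_forms_independent:
  fixes c :: "('d::finite \<Rightarrow> nat) \<Rightarrow> real"
  assumes "(\<lambda>z. \<Sum>k\<in>{k. mdeg k \<le> n}. c k * cone_mono k (n - mdeg k) z) \<in> polys_le (int n - 1)"
    and k: "mdeg k \<le> n"
  shows "c k = 0"
proof -
  define F where "F z = (\<Sum>k\<in>{k. mdeg k \<le> n}. c k * cone_mono k (n - mdeg k) z)" for z
  have F: "F \<in> polys_le (int n - 1)" using assms(1) unfolding F_def[abs_def] .
  have "F z = 0" for z
  proof -
    obtain p where p: "\<And>s. F (s *\<^sub>R z) = poly p s" "coeff p n = 0"
      using polys_le_ray[OF F, of z] by (metis diff_less of_nat_0_less_iff zero_less_one less_irrefl zle_diff1_eq not_le)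
    have "F (s *\<^sub>R z) = s ^ n * F z" for s
      unfolding F_def sum_distrib_left by (intro sum.cong) (auto simp: cone_mono_scaleR)
    then have "poly (monom (F z) n) = poly p" using p(1) by (auto simp: poly_monom fun_eq_iff mult.commute)
    then have "monom (F z) n = p" by (simp add: poly_eq_poly_eq_iff)
    then show ?thesis using p(2) by (metis coeff_monom)
  qed
  \<comment> \<open>Setting t = 1 loses nothing, as the exponent of t is determined by k.\<close>
  from this[of "(_, 1)"] have "(\<Sum>k\<in>{k. mdeg k \<le> n}. c k * mpow x k) = 0" for x
    by (simp add: F_def cone_mono_def)
  from mpow_independent[OF finite_mdeg_le this] k show ?thesis by simp
qed

lemma polys_le_leading:
  fixes f :: "(real ^ 'd::finite) \<times> real \<Rightarrow> real"
  assumes "f \<in> polys_le (int n)"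
  obtains c where "f - (\<lambda>z. \<Sum>k\<in>{k. mdeg k \<le> n}. c k * cone_mono k (n - mdeg k) z) \<in> polys_le (int n - 1)"
proof -
  let ?F = "\<lambda>(c :: ('d \<Rightarrow> nat) \<Rightarrow> real) z. \<Sum>k\<in>{k. mdeg k \<le> n}. c k * cone_mono k (n - mdeg k) z"
  have "\<exists>c. f - ?F c \<in> polys_le (int n - 1)"
    using assms
  proof (induction f rule: polys_le_induct)
    case (mono k j)
    show ?case
    proof (cases "mdeg k + j = n")
      case True
      then have "?F (\<lambda>l. if l = k then 1 else 0) = (\<lambda>z. \<Sum>l\<in>{l. mdeg l \<le> n}. if l = k then cone_mono k j z else 0)"
        by (intro ext sum.cong) auto
      also have "\<dots> = cone_mono k j"
        using True by (intro ext, subst sum.delta[OF finite_mdeg_le]) auto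
      finally have "?F (\<lambda>l. if l = k then 1 else 0) = cone_mono k j" .
      then show ?thesis by (intro exI[of _ "\<lambda>l. if l = k then 1 else 0"]) (simp add: polys_le_zero[unfolded zero_fun_def])
    next
      case False
      then have "cone_mono k j \<in> polys_le (int n - 1)" using mono by (intro cone_mono_in_polys_le) simp
      moreover have "cone_mono k j - ?F (\<lambda>_. 0) = cone_mono k j" by (simp add: fun_eq_iff)
      ultimately show ?thesis by (intro exI[of _ "\<lambda>_. 0"]) (simp only:)
    qed
  next
    case zero
    have "(\<lambda>z. 0) - ?F (\<lambda>_. 0) = 0" by (simp add: fun_eq_iff)
    then show ?case by (intro exI[of _ "\<lambda>_. 0"]) (simp only: polys_le_zero)
  next
    case (add f g)
    then obtain c c' where c: "f - ?F c \<in> polys_le (int n - 1)" "g - ?F c' \<in> polys_le (int n - 1)" by blast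
    have "(\<lambda>z. f z + g z) - ?F (\<lambda>k. c k + c' k) = (\<lambda>z. (f - ?F c) z + (g - ?F c') z)"
      by (simp add: fun_eq_iff distrib_right sum.distrib)
    then show ?case using polys_le_add[OF c] by (intro exI[of _ "\<lambda>k. c k + c' k"]) (simp only:)
  next
    case (cmult a f)
    then obtain c where c: "f - ?F c \<in> polys_le (int n - 1)" by blast
    have "(\<lambda>z. a * f z) - ?F (\<lambda>k. a * c k) = (\<lambda>z. a * (f - ?F c) z)"
      by (simp add: fun_eq_iff right_diff_distrib sum_distrib_left mult.assoc)
    then show ?case using polys_le_cmult[OF c] by (intro exI[of _ "\<lambda>k. a * c k"]) (simp only:)
  qed
  then show thesis using that by blast
qed

section \<open>The monomial basis\<close>

context radial_weight
begin

lemma polys_le_W_integrable: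
  fixes f :: "(real ^ 'd::finite) \<times> real \<Rightarrow> real"
  assumes "f \<in> polys_le N"
  shows "integrable lborel (\<lambda>z. f z * W z)"
  using assms
proof (induction f rule: polys_le_induct)
  case (mono k j)
  show ?case by (rule W_moment)
qed (simp_all add: distrib_right mult.assoc)

text \<open>h is nonzero on a set of positive measure beyond some height \<epsilon>. For almost
  every x with |x| < \<epsilon> the polynomial f(x, .) vanishes at almost every such height, hence
  everywhere; continuity removes the exceptional x, and f is 0 on an open cylinder.\<close>

lemma W_positive_definite:
  fixes f :: "(real ^ 'd::finite) \<times> real \<Rightarrow> real"
  assumes f: "f \<in> polys_le N" and zero: "(LINT z|lborel. f z * f z * W z) = 0"
  shows "f = 0"
proof -
  have "integrable lborel (\<lambda>z. f z * f z * W z)"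
    using polys_le_W_integrable[OF polys_le_mult[OF f f]] .
  then have "AE z in lborel. f z * f z * W z = 0"
    using integral_nonneg_eq_0_iff_AE[of lborel "\<lambda>z. f z * f z * W z"] zero by (simp add: W_nonneg)
  then have "AE z in lborel \<Otimes>\<^sub>M lborel. f z * W z = 0"
    unfolding lborel_prod by eventually_elim auto
  from lborel_pair.AE_pair[OF this]
  have ae: "AE x in lborel. AE t in lborel. f (x, t) * W (x, t) = 0" .
  \<comment> \<open>If h vanished almost everywhere above every 1/(n+1), it would vanish almost
    everywhere, by countability.\<close>
  obtain n :: nat where n: "\<not> (AE t in lborel. t > 1 / real (Suc n) \<longrightarrow> h t = 0)"
  proof (rule ccontr)
    assume "\<not> thesis"
    then have "AE t in lborel. \<forall>n. t > 1 / real (Suc n) \<longrightarrow> h t = 0"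
      unfolding AE_all_countable using that by blast
    then have "AE t in lborel. h t = 0"
    proof eventually_elim
      case (elim t)
      show ?case
      proof (cases "t > 0")
        case True
        then obtain n where "1 / real (Suc n) < t" using reals_Archimedean[of t] by (auto simp: inverse_eq_divide)
        then show ?thesis using elim by blast
      qed (simp add: h_zero)
    qed
    then show False using h_not_AE_zero by simp
  qed
  define \<epsilon> where "\<epsilon> = 1 / real (Suc n)"
  have \<epsilon>: "\<epsilon> > 0" by (simp add: \<epsilon>_def)
  have fibre: "f (x, t) = 0" if x: "norm x < \<epsilon>" and "AE t in lborel. f (x, t) * W (x, t) = 0" for x t
  proof -
    obtain p where p: "\<And>s. f ((x, 0) + s *\<^sub>R (0, 1)) = poly p s"
      using polys_le_line[OF f] by blast
    have "p = 0"
    proof (rule ccontr)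
      assume "p \<noteq> 0"
      then have "finite {t. poly p t = 0}" by (rule poly_roots_finite)
      from AE_lborel_finite[OF this] that(2) have "AE t in lborel. t > 1 / real (Suc n) \<longrightarrow> h t = 0"
      proof eventually_elim
        case (elim t)
        show ?case
        proof
          assume "t > 1 / real (Suc n)"
          then have "\<epsilon> < t" by (simp only: \<epsilon>_def)
          then have t: "norm x < t" "t > 0" using x \<epsilon> by linarith+
          then have "(norm x)\<^sup>2 < t\<^sup>2" by (intro power_strict_mono) auto
          then have "ball_wt \<mu> t x > 0" using t by (simp add: ball_wt_def)
          moreover have "f (x, t) \<noteq> 0" using elim(1) p[of t] by simp
          ultimately show "h t = 0" using elim(2) t by (simp add: W_def)
        qed
      qed
      then show False using n by simp
    qed
    then show ?thesis using p[of t] by simp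
  qed
  show ?thesis
  proof (rule polys_le_zero_on_open[OF f])
    show "open (ball (0 :: real ^ 'd) \<epsilon> \<times> (UNIV :: real set))" by (intro open_Times) auto
    show "(0, 0) \<in> ball (0 :: real ^ 'd) \<epsilon> \<times> (UNIV :: real set)" using \<epsilon> by simp
    fix z assume z: "z \<in> ball (0 :: real ^ 'd) \<epsilon> \<times> (UNIV :: real set)"
    obtain x t where xt: "z = (x, t)" by fastforce
    \<comment> \<open>Open and null, hence empty.\<close>
    define U where "U = {y. norm y < \<epsilon> \<and> f (y, t) \<noteq> 0}"
    have cont: "continuous_on UNIV (\<lambda>y. f (y, t))"
      by (rule continuous_on_compose2[OF polys_le_continuous[OF f]]) (auto intro!: continuous_intros)
    have "open U" unfolding U_def
      by (intro open_Collect_conj open_Collect_less open_Collect_neq continuous_intros cont)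
    moreover have "negligible U"
    proof -
      have "AE y in lborel. y \<notin> U" using ae
      proof eventually_elim
        case (elim y)
        then show ?case using fibre[of y t] by (auto simp: U_def)
      qed
      then have "AE y in lebesgue. y \<notin> U" by (rule AE_completion)
      then have "U \<in> null_sets lebesgue"
        using \<open>open U\<close> AE_iff_null_sets[of U lebesgue] by simp
      then show ?thesis by (simp add: negligible_iff_null_sets)
    qed
    ultimately have "U = {}" using open_not_negligible by blast
    then show "f z = 0" using z xt by (auto simp: U_def)
  qed
qed

section \<open>The polynomials S and V over the radial weight: leading forms and
  orthogonality\<close>

definition cone_S :: "('d::finite \<Rightarrow> nat) \<Rightarrow> nat \<Rightarrow> (real ^ 'd) \<times> real \<Rightarrow> real"
  where "cone_S k n = (\<lambda>(x, t). poly (radial_op (mdeg k) (n - mdeg k)) t * ball_V_hom \<mu> k x t)"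

lemma ball_V_hom_cone_mono:
  "t ^ l * ball_V_hom \<mu> k x t = (\<Sum>j\<in>halves k. bcoef \<mu> k j * cone_mono (minus2 k j) (2 * mdeg j + l) (x, t))"
  by (simp add: ball_V_hom_def cone_mono_def sum_distrib_left power_add mult_ac)

lemma ball_V_hom_in_polys_le:
  assumes "int (mdeg k + l) \<le> N"
  shows "(\<lambda>(x, t). t ^ l * ball_V_hom \<mu> k x t) \<in> polys_le N"
  unfolding ball_V_hom_cone_mono case_prod_beta' prod.collapse
proof (intro polys_le_sum polys_le_cmult cone_mono_in_polys_le)
  fix j assume "j \<in> halves k"
  from mdeg_minus2[OF this] assms show "int (mdeg (minus2 k j) + (2 * mdeg j + l)) \<le> N" by simp
qed

lemma cone_S_expand:
  "cone_S k n = (\<lambda>z. \<Sum>l\<le>n - mdeg k. coeff (radial_op (mdeg k) (n - mdeg k)) l *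
    (\<lambda>(x, t). t ^ l * ball_V_hom \<mu> k x t) z)"
  by (simp add: cone_S_def fun_eq_iff poly_altdef radial_op(1) sum_distrib_right mult.assoc)

lemma cone_S_in_polys_le:
  assumes "mdeg k \<le> n"
  shows "cone_S k n \<in> polys_le (int n)"
  unfolding cone_S_expand using assms
  by (intro polys_le_sum polys_le_cmult ball_V_hom_in_polys_le) auto

lemma cone_S_leading:
  assumes "mdeg k \<le> n"
  shows "cone_S k n - (\<lambda>(x, t). t ^ (n - mdeg k) * ball_V_hom \<mu> k x t) \<in> polys_le (int n - 1)"
proof -
  have "coeff (radial_op (mdeg k) (n - mdeg k)) (n - mdeg k) = 1"
    using radial_op(1,2)[of "mdeg k" "n - mdeg k"] by simp
  then have "cone_S k n - (\<lambda>(x, t). t ^ (n - mdeg k) * ball_V_hom \<mu> k x t)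
    = (\<lambda>z. \<Sum>l<n - mdeg k. coeff (radial_op (mdeg k) (n - mdeg k)) l *
        (\<lambda>(x, t). t ^ l * ball_V_hom \<mu> k x t) z)"
    unfolding cone_S_expand by (auto simp: fun_eq_iff simp flip: lessThan_Suc_atMost)
  also have "\<dots> \<in> polys_le (int n - 1)"
    using assms by (intro polys_le_sum polys_le_cmult ball_V_hom_in_polys_le) auto
  finally show ?thesis .
qed

text \<open>Against t^b x^a, every term of t^l times the homogenized V_k has the same radial moment,
  since homogeneity makes the power of t independent of j. The integral is therefore a radial sum
  times a ball sum, and one of the two is 0.\<close>

lemma cone_S_orthogonal:
  fixes k :: "'d::finite \<Rightarrow> nat"
  assumes lam: "lam \<mu> CARD('d) > 0" and k: "mdeg k \<le> n" and g: "g \<in> polys_le (int n - 1)"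
  shows "(LINT z|lborel. cone_S k n z * g z * W z) = 0"
proof -
  define q where "q = radial_op (mdeg k) (n - mdeg k)"
  have int: "integrable lborel (\<lambda>z. cone_S k n z * g z * W z)" if "g \<in> polys_le N" for g N
    using polys_le_W_integrable[OF polys_le_mult[OF cone_S_in_polys_le[OF k] that]] .
  \<comment> \<open>Membership is carried along because splitting the integral of a sum requires
    integrability of the parts.\<close>
  have "g \<in> polys_le (int n - 1) \<and> (LINT z|lborel. cone_S k n z * g z * W z) = 0"
    using g
  proof (induction g rule: polys_le_induct)
    case (mono a b)
    have "cone_S k n z * cone_mono a b z * W z = (\<Sum>l\<le>n - mdeg k. \<Sum>j\<in>halves k.
        coeff q l * bcoef \<mu> k j * (cone_mono (\<lambda>i. minus2 k j i + a i) (2 * mdeg j + l + b) z * W z))" for z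
    proof -
      obtain x t where z: "z = (x, t)" by fastforce
      show ?thesis
        by (simp add: cone_S_expand q_def z ball_V_hom_cone_mono sum_distrib_left sum_distrib_right
          mult.assoc flip: cone_mono_mult)
    qed
    then have "(LINT z|lborel. cone_S k n z * cone_mono a b z * W z) = (\<Sum>l\<le>n - mdeg k. \<Sum>j\<in>halves k.
        coeff q l * bcoef \<mu> k j * (ball_moment \<mu> (\<lambda>i. minus2 k j i + a i) *
          moment (mdeg (\<lambda>i. minus2 k j i + a i) + (2 * mdeg j + l + b))))"
      by (simp add: W_moment)
    also have "\<dots> = (\<Sum>l\<le>n - mdeg k. \<Sum>j\<in>halves k.
        (coeff q l * moment (mdeg k + mdeg a + b + l)) * (bcoef \<mu> k j * ball_moment \<mu> (\<lambda>i. minus2 k j i + a i)))"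
    proof (intro sum.cong refl)
      fix l j assume "j \<in> halves k"
      from mdeg_minus2[OF this]
      have "mdeg (\<lambda>i. minus2 k j i + a i) + (2 * mdeg j + l + b) = mdeg k + mdeg a + b + l"
        by (simp add: mdeg_add)
      then show "coeff q l * bcoef \<mu> k j * (ball_moment \<mu> (\<lambda>i. minus2 k j i + a i) *
          moment (mdeg (\<lambda>i. minus2 k j i + a i) + (2 * mdeg j + l + b))) =
        (coeff q l * moment (mdeg k + mdeg a + b + l)) * (bcoef \<mu> k j * ball_moment \<mu> (\<lambda>i. minus2 k j i + a i))"
        by (simp only: mult_ac)
    qed
    also have "\<dots> = (\<Sum>l\<le>n - mdeg k. coeff q l * moment (mdeg k + mdeg a + b + l)) *
        (\<Sum>j\<in>halves k. bcoef \<mu> k j * ball_moment \<mu> (\<lambda>i. minus2 k j i + a i))"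
      by (simp add: sum_product)
    also have "\<dots> = 0"
    proof (cases "mdeg a < mdeg k")
      case True
      from ball_V_orthogonal[OF lam ball_moment_rec[OF mu lam] True] show ?thesis by simp
    next
      case False
      \<comment> \<open>The power of t left to test the radial polynomial after t^(2|k|) has been
        given to the weight; it is below n - |k| because |a| + b <= n - 1.\<close>
      define r where "r = mdeg a + b - mdeg k"
      have r: "r < n - mdeg k" "mdeg k + mdeg a + b + l = l + r + 2 * mdeg k" for l
        using False mono by (simp_all add: r_def)
      have deg: "degree (q * monom 1 r) = n - mdeg k + r"
        using radial_op(1,2)[of "mdeg k" "n - mdeg k"]
        by (subst degree_mult_eq) (auto simp: q_def degree_monom_eq)
      have "0 = poly_functional (mdeg k) (q * monom 1 r)"
        unfolding q_def using radial_op(3)[of "monom 1 r"] r(1) by (simp add: degree_monom_eq)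
      also have "\<dots> = (\<Sum>i\<le>n - mdeg k + r. coeff (q * monom 1 r) i * moment (i + 2 * mdeg k))"
        by (simp add: poly_functional_moment deg)
      also have "\<dots> = (\<Sum>i\<in>{r..n - mdeg k + r}. coeff (q * monom 1 r) i * moment (i + 2 * mdeg k))"
        by (intro sum.mono_neutral_right) (auto simp: mult.commute[of q] coeff_monom_mult)
      also have "\<dots> = (\<Sum>l\<le>n - mdeg k. coeff q l * moment (mdeg k + mdeg a + b + l))"
        unfolding r(2)
        by (rule sum.reindex_bij_witness[of _ "\<lambda>l. l + r" "\<lambda>i. i - r"])
           (auto simp: mult.commute[of q] coeff_monom_mult)
      finally show ?thesis by simp
    qed
    finally show ?case using cone_mono_in_polys_le[OF mono] by simp
  next
    case zero
    show ?case using polys_le_zero by (simp add: zero_fun_def)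
  next
    case (add f g)
    have "(LINT z|lborel. cone_S k n z * (f z + g z) * W z)
        = (LINT z|lborel. cone_S k n z * f z * W z) + (LINT z|lborel. cone_S k n z * g z * W z)"
      using add int by (subst Bochner_Integration.integral_add[symmetric])
        (auto simp: algebra_simps intro!: Bochner_Integration.integral_cong)
    then show ?case using add polys_le_add by auto
  next
    case (cmult c f)
    have "(LINT z|lborel. cone_S k n z * (c * f z) * W z) = c * (LINT z|lborel. cone_S k n z * f z * W z)"
      by (subst integral_mult_right_zero[symmetric]) (simp add: mult_ac)
    then show ?case using cmult polys_le_cmult by auto
  qed
  then show ?thesis ..
qed

definition cone_V :: "('d::finite \<Rightarrow> nat) \<Rightarrow> nat \<Rightarrow> (real ^ 'd) \<times> real \<Rightarrow> real"
  where "cone_V k n = (\<lambda>z. \<Sum>j\<in>halves k. ccoef \<mu> k j * cone_S (minus2 k j) n z)"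

lemma mdeg_minus2_le:
  assumes "j \<in> halves k" "mdeg k \<le> n"
  shows "mdeg (minus2 k j) \<le> n"
  using mdeg_minus2[OF assms(1)] assms(2) by simp

text \<open>The radial polynomials are monic, so S_{k-2j,n} starts with t^(n-|k|+2|j|) times the
  homogenized V_{k-2j}; the choice of c makes these add up to the monomial.\<close>

lemma cone_V_leading:
  fixes k :: "'d::finite \<Rightarrow> nat"
  assumes lam: "lam \<mu> CARD('d) > 0" and k: "mdeg k \<le> n"
  shows "cone_V k n - cone_mono k (n - mdeg k) \<in> polys_le (int n - 1)"
proof -
  let ?T = "\<lambda>k (x, t). t ^ (n - mdeg k) * ball_V_hom \<mu> k x t"
  have "cone_mono k (n - mdeg k) (x, t) = (\<Sum>j\<in>halves k. ccoef \<mu> k j * ?T (minus2 k j) (x, t))" for x t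
  proof -
    have "(\<Sum>j\<in>halves k. ccoef \<mu> k j * ?T (minus2 k j) (x, t))
      = (\<Sum>j\<in>halves k. ccoef \<mu> k j * (t ^ (n - mdeg k + 2 * mdeg j) * ball_V_hom \<mu> (minus2 k j) x t))"
    proof (intro sum.cong refl)
      fix j assume "j \<in> halves k"
      from mdeg_minus2[OF this] k have "n - mdeg (minus2 k j) = n - mdeg k + 2 * mdeg j" by linarith
      then show "ccoef \<mu> k j * ?T (minus2 k j) (x, t)
        = ccoef \<mu> k j * (t ^ (n - mdeg k + 2 * mdeg j) * ball_V_hom \<mu> (minus2 k j) x t)" by simp
    qed
    also have "\<dots> = cone_mono k (n - mdeg k) (x, t)"
      by (subst sum_V_coeffs_leading[OF lam]) (simp add: cone_mono_def)
    finally show ?thesis ..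
  qed
  then have "cone_V k n - cone_mono k (n - mdeg k)
    = (\<lambda>z. \<Sum>j\<in>halves k. ccoef \<mu> k j * (cone_S (minus2 k j) n - ?T (minus2 k j)) z)"
    by (auto simp: cone_V_def fun_eq_iff sum_subtractf right_diff_distrib)
  also have "\<dots> \<in> polys_le (int n - 1)"
    by (intro polys_le_sum polys_le_cmult cone_S_leading mdeg_minus2_le k)
  finally show ?thesis .
qed

lemma cone_V_in_polys_le:
  assumes "mdeg k \<le> n"
  shows "cone_V k n \<in> polys_le (int n)"
  unfolding cone_V_def by (intro polys_le_sum polys_le_cmult cone_S_in_polys_le mdeg_minus2_le assms)

lemma cone_V_orthogonal:
  fixes k :: "'d::finite \<Rightarrow> nat"
  assumes lam: "lam \<mu> CARD('d) > 0" and k: "mdeg k \<le> n" and g: "g \<in> polys_le (int n - 1)"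
  shows "(LINT z|lborel. cone_V k n z * g z * W z) = 0"
proof -
  have int: "integrable lborel (\<lambda>z. cone_S (minus2 k j) n z * g z * W z)" if "j \<in> halves k" for j
    using polys_le_W_integrable[OF polys_le_mult[OF cone_S_in_polys_le[OF mdeg_minus2_le[OF that k]] g]] .
  have "(LINT z|lborel. cone_V k n z * g z * W z) =
    (LINT z|lborel. (\<Sum>j\<in>halves k. ccoef \<mu> k j * (cone_S (minus2 k j) n z * g z * W z)))"
    by (simp add: cone_V_def sum_distrib_right mult.assoc)
  also have "\<dots> = (\<Sum>j\<in>halves k. ccoef \<mu> k j * (LINT z|lborel. cone_S (minus2 k j) n z * g z * W z))"
    using int by (subst Bochner_Integration.integral_sum) auto
  also have "\<dots> = 0"
    by (intro sum.neutral ballI) (simp add: cone_S_orthogonal[OF lam mdeg_minus2_le[OF _ k] g])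
  finally show ?thesis .
qed

end

text \<open>For fixed k, B_{i,m} still contains (-k/2)_i ((1-k)/2)_i / i!, so dependence on |i|
  alone is expressed for the factor \<beta> that remains beside it. The clause on arbitrary B makes
  precise that there is only one monomial basis.\<close>

theorem theorem3p3:
  fixes w :: "real \<Rightarrow> real" and \<mu> :: real and n :: nat
  assumes d: "CARD('d::finite) \<ge> 2"
    and mu: "\<mu> > - 1 / 2"
    and w: "admissible_weight CARD('d) \<mu> w"
  shows "(\<forall>k :: 'd \<Rightarrow> nat. mdeg k \<le> n \<longrightarrow>
            V_poly w \<mu> k n - cone_mono k (n - mdeg k) \<in> polys_le (int n - 1))
       \<and> is_monomial_basis w \<mu> n {V_poly w \<mu> k n |k :: 'd \<Rightarrow> nat. mdeg k \<le> n}
       \<and> (\<forall>B. is_monomial_basis w \<mu> n B \<longrightarrow> B = {V_poly w \<mu> k n |k :: 'd \<Rightarrow> nat. mdeg k \<le> n})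
       \<and> (\<forall>k :: 'd \<Rightarrow> nat. mdeg k \<le> n \<longrightarrow>
            (\<forall>x t. V_poly w \<mu> k n (x, t) =
              (\<Sum>i\<in>halves k. mpow x (minus2 k i) *
                (\<Sum>m\<le>mdeg i.
                   poly (monic_op w (2 * (real (mdeg k) - 2 * real m) + 2 * \<mu> + real CARD('d) - 1)
                           (n - mdeg k + 2 * m)) t
                   * t ^ (2 * mdeg i - 2 * m) * Bcoef \<mu> k i m)))
          \<and> (\<exists>\<beta> :: nat \<Rightarrow> nat \<Rightarrow> real. \<forall>i\<in>halves k. \<forall>m\<le>mdeg i.
              Bcoef \<mu> k i m = half_poch k i / mfact i * \<beta> (mdeg i) m))"
proof -
  have lam: "lam \<mu> CARD('d) > 0" by (rule lam_pos[OF mu d])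
  obtain h where h: "radial_weight h \<mu>"
    and monic: "\<And>m j. monic_op w (2 * real m + 2 * \<mu> + real CARD('d) - 1) j = radial_weight.radial_op h m j"
    and inner: "\<And>f g :: (real ^ 'd) \<times> real \<Rightarrow> real. (\<lambda>z. f z * g z) \<in> borel_measurable borel \<Longrightarrow>
       cone_inner w \<mu> f g = (LINT z|lborel. f z * g z * radial_weight.W h \<mu> z)"
    using admissible_transfer[OF mu w] by blast
  interpret radial_weight h \<mu> by (rule h)
  define K where "K = {k :: 'd \<Rightarrow> nat. mdeg k \<le> n}"
  define V where "V k = V_poly w \<mu> k n" for k :: "'d \<Rightarrow> nat"
  have S_eq: "S_poly w \<mu> k n = cone_S k n" for k :: "'d \<Rightarrow> nat"
    unfolding S_poly_def cone_S_def monic ..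
  have V_eq: "V k = cone_V k n" for k
    unfolding V_def V_poly_def cone_V_def S_eq ..
  have inner_polys: "cone_inner w \<mu> f g = (LINT z|lborel. f z * g z * W z)"
    if "f \<in> polys_le M" "g \<in> polys_le N" for f g :: "(real ^ 'd) \<times> real \<Rightarrow> real" and M N
    by (rule inner[OF polys_le_measurable[OF polys_le_mult[OF that]]])
  have lead: "V k - cone_mono k (n - mdeg k) \<in> polys_le (int n - 1)" if "k \<in> K" for k
    using cone_V_leading[OF lam, of k n] that by (simp add: V_eq K_def)
  have V_orth: "V k \<in> orth_space w \<mu> n" if "k \<in> K" for k
  proof -
    have k: "mdeg k \<le> n" using that by (simp add: K_def)
    show ?thesis
      unfolding orth_space_def V_eq
      using inner_polys[OF cone_V_in_polys_le[OF k]] cone_V_orthogonal[OF lam k] cone_V_in_polys_le[OF k]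
      by simp
  qed
  have subspace: "fn.subspace (orth_space w \<mu> n :: ((real ^ 'd) \<times> real \<Rightarrow> real) set)"
    unfolding fn.subspace_def
  proof (intro conjI ballI allI)
    show "0 \<in> orth_space w \<mu> n"
      by (simp add: orth_space_def polys_le_zero cone_inner_def set_lebesgue_integral_def)
  next
    fix f g :: "(real ^ 'd) \<times> real \<Rightarrow> real"
    assume f: "f \<in> orth_space w \<mu> n" and g: "g \<in> orth_space w \<mu> n"
    then have fg: "f \<in> polys_le (int n)" "g \<in> polys_le (int n)" by (auto simp: orth_space_def)
    have sum: "f + g \<in> polys_le (int n)" using polys_le_add[OF fg] by (simp add: plus_fun_def)
    have "cone_inner w \<mu> (f + g) p = 0" if p: "p \<in> polys_le (int n - 1)" for p
    proof -
      have "cone_inner w \<mu> (f + g) p = (LINT z|lborel. f z * p z * W z + g z * p z * W z)"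
        by (simp add: inner_polys[OF sum p] distrib_right)
      also have "\<dots> = cone_inner w \<mu> f p + cone_inner w \<mu> g p"
        using fg[THEN polys_le_mult, OF p, THEN polys_le_W_integrable]
        by (simp add: inner_polys[OF fg(1) p] inner_polys[OF fg(2) p])
      finally show ?thesis using f g p by (simp add: orth_space_def)
    qed
    then show "f + g \<in> orth_space w \<mu> n" using sum by (simp add: orth_space_def)
  next
    fix c and f :: "(real ^ 'd) \<times> real \<Rightarrow> real"
    assume f: "f \<in> orth_space w \<mu> n"
    then have fn: "f \<in> polys_le (int n)" by (simp add: orth_space_def)
    have "cone_inner w \<mu> (\<lambda>z. c * f z) p = 0" if p: "p \<in> polys_le (int n - 1)" for p
    proof -
      have "cone_inner w \<mu> (\<lambda>z. c * f z) p = c * cone_inner w \<mu> f p"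
        by (simp add: inner_polys[OF polys_le_cmult[OF fn] p] inner_polys[OF fn p] mult.assoc)
      then show ?thesis using f p by (simp add: orth_space_def)
    qed
    then show "(\<lambda>z. c * f z) \<in> orth_space w \<mu> n" using polys_le_cmult[OF fn] by (simp add: orth_space_def)
  qed
  \<comment> \<open>Such an f is orthogonal to itself.\<close>
  have vanish: "f = 0" if "f \<in> orth_space w \<mu> n" "f \<in> polys_le (int n - 1)"
    for f :: "(real ^ 'd) \<times> real \<Rightarrow> real"
  proof -
    have "cone_inner w \<mu> f f = 0" using that by (simp add: orth_space_def)
    then show ?thesis using W_positive_definite[OF that(2)] inner_polys[OF that(2) that(2)] by simp
  qed
  \<comment> \<open>A vanishing combination of the V_k forces the same combination of leading
    monomials to have degree at most n - 1.\<close>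
  have combination: "c k = 0" if "(\<lambda>z. \<Sum>k\<in>K. c k * V k z) = 0" "k \<in> K" for c k
  proof -
    have "(\<lambda>z. \<Sum>k\<in>K. c k * cone_mono k (n - mdeg k) z)
      = (\<lambda>z. \<Sum>k\<in>K. - c k * (V k - cone_mono k (n - mdeg k)) z)"
      using that(1) by (simp add: fun_eq_iff algebra_simps sum_subtractf)
    also have "\<dots> \<in> polys_le (int n - 1)"
      by (intro polys_le_sum polys_le_cmult lead)
    finally show ?thesis
      using leading_forms_independent[of c n k] that(2) by (simp add: K_def)
  qed
  \<comment> \<open>Independence concerns the set of values, so indices must be recoverable from
    values. Equal values would give a vanishing combination with coefficients 1 and -1.\<close>
  have inj: "inj_on V K"
  proof (rule inj_onI)
    fix k l assume k: "k \<in> K" and l: "l \<in> K" and eq: "V k = V l"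
    show "k = l"
    proof (rule ccontr)
      assume ne: "k \<noteq> l"
      define c where "c j = (if j = k then 1 else if j = l then - 1 else 0 :: real)" for j
      have "(\<Sum>j\<in>K. c j * V j z) = (\<Sum>j\<in>{k, l}. c j * V j z)" for z
        using k l finite_mdeg_le[of n] by (intro sum.mono_neutral_right) (auto simp: c_def K_def)
      then have "(\<lambda>z. \<Sum>j\<in>K. c j * V j z) = 0"
        using ne by (intro ext) (simp add: c_def eq)
      from combination[OF this k] show False by (simp add: c_def)
    qed
  qed
  have finK: "finite K" unfolding K_def by (rule finite_mdeg_le)
  have indep: "\<not> fn.dependent (V ` K)"
    unfolding fn.dependent_finite[OF finite_imageI[OF finK]]
  proof
    assume "\<exists>u. (\<exists>v\<in>V ` K. u v \<noteq> 0) \<and> (\<Sum>v\<in>V ` K. (\<lambda>z. u v * v z)) = 0"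
    then obtain u k where u: "k \<in> K" "u (V k) \<noteq> 0" "(\<Sum>v\<in>V ` K. (\<lambda>z. u v * v z)) = 0" by blast
    from u(3) have "(\<lambda>z. \<Sum>k\<in>K. u (V k) * V k z) = 0"
      unfolding sum.reindex[OF inj] sum_fun_eq by simp
    from combination[OF this u(1)] u(2) show False by simp
  qed
  have span: "fn.span (V ` K) = orth_space w \<mu> n"
  proof
    show "fn.span (V ` K) \<subseteq> orth_space w \<mu> n"
      by (rule fn.span_minimal[OF _ subspace]) (use V_orth in blast)
    show "orth_space w \<mu> n \<subseteq> fn.span (V ` K)"
    proof
      fix f :: "(real ^ 'd) \<times> real \<Rightarrow> real" assume f: "f \<in> orth_space w \<mu> n"
      then have "f \<in> polys_le (int n)" by (simp add: orth_space_def)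
      then obtain c where c: "f - (\<lambda>z. \<Sum>k\<in>K. c k * cone_mono k (n - mdeg k) z) \<in> polys_le (int n - 1)"
        unfolding K_def by (rule polys_le_leading)
      define g where "g = (\<lambda>z. \<Sum>k\<in>K. c k * V k z)"
      have g: "g \<in> fn.span (V ` K)"
        unfolding g_def sum_fun_eq[symmetric] by (intro fn.span_sum fn.span_scale fn.span_base) blast
      \<comment> \<open>f and g share the leading form, so the difference is both orthogonal and of
        lower degree.\<close>
      have "f - g = (f - (\<lambda>z. \<Sum>k\<in>K. c k * cone_mono k (n - mdeg k) z)) -
          (\<lambda>z. \<Sum>k\<in>K. c k * (V k - cone_mono k (n - mdeg k)) z)"
        by (simp add: g_def fun_eq_iff algebra_simps sum_subtractf)
      also have "\<dots> \<in> polys_le (int n - 1)"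
        by (intro polys_le_diff c polys_le_sum polys_le_cmult lead)
      finally have "f - g \<in> polys_le (int n - 1)" .
      moreover have "g \<in> orth_space w \<mu> n"
        using g fn.span_minimal[OF _ subspace, of "V ` K"] V_orth by blast
      then have "f - g \<in> orth_space w \<mu> n" using f by (intro fn.subspace_diff[OF subspace])
      ultimately have "f - g = 0" by (rule vanish[rotated])
      then show "f \<in> fn.span (V ` K)" using g by simp
    qed
  qed
  have set_eq: "{V_poly w \<mu> k n |k :: 'd \<Rightarrow> nat. mdeg k \<le> n} = V ` K"
    by (auto simp: V_def K_def)
  have basis: "is_monomial_basis w \<mu> n (V ` K)"
    unfolding is_monomial_basis_def using indep span lead by (auto simp: K_def)
  have unique: "B = V ` K" if B: "is_monomial_basis w \<mu> n B" for B
  proof -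
    have sub: "B \<subseteq> V ` K"
    proof
      fix f assume f: "f \<in> B"
      then obtain k where k: "k \<in> K" "f - cone_mono k (n - mdeg k) \<in> polys_le (int n - 1)"
        using B unfolding is_monomial_basis_def K_def by blast
      have "f \<in> orth_space w \<mu> n" using f B fn.span_base unfolding is_monomial_basis_def by blast
      then have "f - V k \<in> orth_space w \<mu> n" using V_orth[OF k(1)] by (intro fn.subspace_diff[OF subspace])
      moreover have "f - V k = (f - cone_mono k (n - mdeg k)) - (V k - cone_mono k (n - mdeg k))" by simp
      then have "f - V k \<in> polys_le (int n - 1)" using polys_le_diff[OF k(2) lead[OF k(1)]] by simp
      ultimately have "f - V k = 0" by (rule vanish)
      then show "f \<in> V ` K" using k(1) by simp
    qed
    \<comment> \<open>A proper subset of an independent set cannot span the same space.\<close>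
    have "V ` K \<subseteq> B"
    proof
      fix v assume v: "v \<in> V ` K"
      show "v \<in> B"
      proof (rule ccontr)
        assume "v \<notin> B"
        then have "fn.span B \<subseteq> fn.span (V ` K - {v})" using sub by (intro fn.span_mono) auto
        moreover have "v \<in> fn.span B"
          using V_orth v B unfolding is_monomial_basis_def by auto
        ultimately show False using indep v unfolding fn.dependent_def by blast
      qed
    qed
    then show ?thesis using sub by blast
  qed
  have formula: "V k (x, t) = (\<Sum>i\<in>halves k. mpow x (minus2 k i) *
      (\<Sum>m\<le>mdeg i. poly (monic_op w (2 * (real (mdeg k) - 2 * real m) + 2 * \<mu> + real CARD('d) - 1)
          (n - mdeg k + 2 * m)) t * t ^ (2 * mdeg i - 2 * m) * Bcoef \<mu> k i m))"
    if k: "mdeg k \<le> n" for k x t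
  proof -
    define F where "F m = poly (monic_op w (2 * (real (mdeg k) - 2 * real m) + 2 * \<mu> + real CARD('d) - 1)
          (n - mdeg k + 2 * m)) t" for m
    have "V k (x, t) = (\<Sum>j\<in>halves k. ccoef \<mu> k j * (F (mdeg j) * ball_V_hom \<mu> (minus2 k j) x t))"
      unfolding V_def V_poly_def
    proof (intro sum.cong refl)
      fix j assume "j \<in> halves k"
      from mdeg_minus2[OF this] k
      have "real (mdeg (minus2 k j)) = real (mdeg k) - 2 * real (mdeg j)"
        "n - mdeg (minus2 k j) = n - mdeg k + 2 * mdeg j" by linarith+
      then show "ccoef \<mu> k j * S_poly w \<mu> (minus2 k j) n (x, t)
          = ccoef \<mu> k j * (F (mdeg j) * ball_V_hom \<mu> (minus2 k j) x t)"
        by (simp add: S_poly_def F_def)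
    qed
    also have "\<dots> = (\<Sum>i\<in>halves k. mpow x (minus2 k i) *
        (\<Sum>m\<le>mdeg i. F m * t ^ (2 * mdeg i - 2 * m) * Bcoef \<mu> k i m))"
      by (rule sum_V_coeffs[OF lam])
    finally show ?thesis unfolding F_def .
  qed
  have only_mdeg: "\<exists>\<beta> :: nat \<Rightarrow> nat \<Rightarrow> real. \<forall>i\<in>halves k. \<forall>m\<le>mdeg i.
      Bcoef \<mu> k i m = half_poch k i / mfact i * \<beta> (mdeg i) m" for k :: "'d \<Rightarrow> nat"
    by (rule exI[of _ "\<lambda>l m. (- 1) ^ m / pochhammer (- real (mdeg k) - lam \<mu> CARD('d) + 1) (l + m) *
        real (l choose m) * (2 * pochhammer (- real (mdeg k) - lam \<mu> CARD('d) + 1) m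
          - pochhammer (- real (mdeg k) - lam \<mu> CARD('d)) m)"])
       (simp add: Bcoef_def mult_ac)
  have lead': "V_poly w \<mu> k n - cone_mono k (n - mdeg k) \<in> polys_le (int n - 1)"
    if "mdeg k \<le> n" for k :: "'d \<Rightarrow> nat"
    using lead[of k] that by (simp add: V_def K_def)
  show ?thesis
    unfolding set_eq
    by (intro conjI allI impI lead' basis unique formula[unfolded V_def] only_mdeg)
qed

end
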